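(* Let $p$ be a prime, $G$ a finite group, $F$ an algebraically closed field of characteristic $p$, and $B$ a block of the group algebra $FG$ with defect group $D$. Let $p^{d}=|D|$ and let $p^{\varepsilon}$ be the exponent of $D$. Then \[ LL(\mathbf{Z}B) \le p^{d} - p^{d-\varepsilon} + 1. \]
   Context: For a finite-dimensional $F$-algebra $A$, $\mathbf{J}A$ denotes its Jacobson radical and $LL(A)$ its Loewy length, i.e. the smallest integer $n\ge 1$ with $(\mathbf{J}A)^{n}=0$. $\mathbf{Z}B$ denotes the center of the block algebra $B$. *)

theory Defs
  imports "HOL-Algebra.Coset" "HOL-Computational_Algebra.Polynomial"
begin

definition grp_alg :: "('g,'b) monoid_scheme \<Rightarrow> ('g \<Rightarrow> 'f::field) set" where
  "grp_alg G = {a. \<forall>x. x \<notin> carrier G \<longrightarrow> a x = 0}"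

definition ga_mult :: "('g,'b) monoid_scheme \<Rightarrow> ('g \<Rightarrow> 'f::field) \<Rightarrow> ('g \<Rightarrow> 'f) \<Rightarrow> ('g \<Rightarrow> 'f)" where
  "ga_mult G a b = (\<lambda>x. if x \<in> carrier G
      then (\<Sum>y\<in>carrier G. a y * b (inv\<^bsub>G\<^esub> y \<otimes>\<^bsub>G\<^esub> x)) else 0)"

definition ga_zero :: "'g \<Rightarrow> 'f::field" where
  "ga_zero = (\<lambda>x. 0)"

definition fspan :: "('g \<Rightarrow> 'f::field) set \<Rightarrow> ('g \<Rightarrow> 'f) set" where
  "fspan X = {v. \<exists>S c. finite S \<and> S \<subseteq> X \<and> v = (\<lambda>x. \<Sum>s\<in>S. c s * s x)}"

definition ga_center :: "('g,'b) monoid_scheme \<Rightarrow> ('g \<Rightarrow> 'f::field) set \<Rightarrow> ('g \<Rightarrow> 'f) set" where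
  "ga_center G A = {z\<in>A. \<forall>b\<in>A. ga_mult G z b = ga_mult G b z}"

text \<open>Block idempotent: primitive idempotent of Z(FG); the block is B = e FG\<close>
definition block_idem :: "('g,'b) monoid_scheme \<Rightarrow> ('g \<Rightarrow> 'f::field) \<Rightarrow> bool" where
  "block_idem G e \<longleftrightarrow> e \<in> ga_center G (grp_alg G) \<and> ga_mult G e e = e \<and> e \<noteq> ga_zero \<and>
     (\<forall>f\<in>ga_center G (grp_alg G). ga_mult G f f = f \<and> ga_mult G f e = f \<longrightarrow> f = ga_zero \<or> f = e)"

definition block_alg :: "('g,'b) monoid_scheme \<Rightarrow> ('g \<Rightarrow> 'f::field) \<Rightarrow> ('g \<Rightarrow> 'f) set" where
  "block_alg G e = {ga_mult G e a | a. a \<in> grp_alg G}"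

definition left_ideal :: "('g,'b) monoid_scheme \<Rightarrow> ('g \<Rightarrow> 'f::field) set \<Rightarrow> ('g \<Rightarrow> 'f) set \<Rightarrow> bool" where
  "left_ideal G A I \<longleftrightarrow> I \<subseteq> A \<and> ga_zero \<in> I \<and>
     (\<forall>x\<in>I. \<forall>y\<in>I. (\<lambda>g. x g + y g) \<in> I) \<and>
     (\<forall>c. \<forall>x\<in>I. (\<lambda>g. c * x g) \<in> I) \<and>
     (\<forall>a\<in>A. \<forall>x\<in>I. ga_mult G a x \<in> I)"

definition maximal_left_ideal :: "('g,'b) monoid_scheme \<Rightarrow> ('g \<Rightarrow> 'f::field) set \<Rightarrow> ('g \<Rightarrow> 'f) set \<Rightarrow> bool" where
  "maximal_left_ideal G A I \<longleftrightarrow> left_ideal G A I \<and> I \<noteq> A \<and>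
     (\<forall>K. left_ideal G A K \<and> I \<subseteq> K \<and> K \<noteq> A \<longrightarrow> K = I)"

definition jacobson_radical :: "('g,'b) monoid_scheme \<Rightarrow> ('g \<Rightarrow> 'f::field) set \<Rightarrow> ('g \<Rightarrow> 'f) set" where
  "jacobson_radical G A = A \<inter> \<Inter> {I. maximal_left_ideal G A I}"

fun ideal_pow :: "('g,'b) monoid_scheme \<Rightarrow> ('g \<Rightarrow> 'f::field) set \<Rightarrow> ('g \<Rightarrow> 'f) set \<Rightarrow> nat \<Rightarrow> ('g \<Rightarrow> 'f) set" where
  "ideal_pow G A J 0 = A"
| "ideal_pow G A J (Suc 0) = J"
| "ideal_pow G A J (Suc (Suc n)) =
     fspan {ga_mult G x y | x y. x \<in> ideal_pow G A J (Suc n) \<and> y \<in> J}"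

definition loewy_length :: "('g,'b) monoid_scheme \<Rightarrow> ('g \<Rightarrow> 'f::field) set \<Rightarrow> nat" where
  "loewy_length G A = (LEAST n. n \<ge> 1 \<and> ideal_pow G A (jacobson_radical G A) n = {ga_zero})"

section \<open>Defect groups (Green: minimal H with e \<in> Tr_H^G((FG)^H))\<close>

definition ga_conj :: "('g,'b) monoid_scheme \<Rightarrow> 'g \<Rightarrow> ('g \<Rightarrow> 'f::field) \<Rightarrow> ('g \<Rightarrow> 'f)" where
  "ga_conj G g a = (\<lambda>x. if x \<in> carrier G then a (inv\<^bsub>G\<^esub> g \<otimes>\<^bsub>G\<^esub> x \<otimes>\<^bsub>G\<^esub> g) else 0)"

definition fixed_pts :: "('g,'b) monoid_scheme \<Rightarrow> 'g set \<Rightarrow> ('g \<Rightarrow> 'f::field) set" where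
  "fixed_pts G H = {a\<in>grp_alg G. \<forall>h\<in>H. ga_conj G h a = a}"

definition rel_trace :: "('g,'b) monoid_scheme \<Rightarrow> 'g set \<Rightarrow> ('g \<Rightarrow> 'f::field) \<Rightarrow> ('g \<Rightarrow> 'f)" where
  "rel_trace G H a = (\<lambda>x. \<Sum>C\<in>{g <#\<^bsub>G\<^esub> H | g. g \<in> carrier G}. ga_conj G (SOME g. g \<in> C) a x)"

definition defect_group :: "('g,'b) monoid_scheme \<Rightarrow> ('g \<Rightarrow> 'f::field) \<Rightarrow> 'g set \<Rightarrow> bool" where
  "defect_group G e D \<longleftrightarrow> subgroup D G \<and> e \<in> rel_trace G D ` fixed_pts G D \<and>
     (\<forall>H. subgroup H G \<and> H \<subseteq> D \<and> e \<in> rel_trace G H ` fixed_pts G H \<longrightarrow> H = D)"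

definition subgroup_exponent :: "('g,'b) monoid_scheme \<Rightarrow> 'g set \<Rightarrow> nat" where
  "subgroup_exponent G D = (LEAST n. n > 0 \<and> (\<forall>x\<in>D. x [^]\<^bsub>G\<^esub> n = \<one>\<^bsub>G\<^esub>))"

definition alg_closed_field :: "'f::field itself \<Rightarrow> bool" where
  "alg_closed_field _ \<longleftrightarrow> (\<forall>q::'f poly. degree q > 0 \<longrightarrow> (\<exists>x. poly q x = 0))"

end

theory Submission
  imports Defs "HOL-Number_Theory.Residues"
begin

text \<open>Let \<open>z\<^sub>1, \<dots>, z\<^sub>m\<close> be nilpotent central elements. A central element \<open>w\<close> of \<open>FG\<close> with \<open>w(ux) = w(x)\<close>
  for all \<open>p\<close>-elements \<open>u\<close> and all \<open>x \<in> C\<^sub>G(u)\<close> lies in the Reynolds ideal, hence is annihilated by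
  every nilpotent central element. So it suffices to see that \<open>w = z\<^sub>1 \<dots> z\<^sub>m e\<close> satisfies this for
  \<open>m = p\<^sup>d - p\<^sup>d\<^sup>-\<^sup>\<epsilon>\<close>. Let \<open>u\<close> have order \<open>p\<^sup>n\<close>. By the Brauer homomorphism we may compute in \<open>FC\<^sub>G(u)\<close>.
  The image of \<open>e\<close> in \<open>F[C\<^sub>G(u)/\<langle>u\<rangle>]\<close> has defect at most \<open>d - n\<close>, so by induction products of \<open>p\<^sup>d\<^sup>-\<^sup>n\<close>
  factors vanish there, that is, they lie in \<open>(u - 1)FC\<^sub>G(u)\<close>. Hence \<open>(p\<^sup>n - 1)p\<^sup>d\<^sup>-\<^sup>n \<le> m\<close> factors give
  an element of \<open>(u - 1)\<^bsup>p^n - 1\<^esup>FC\<^sub>G(u)\<close>, which is annihilated by \<open>u - 1\<close>. The bound on the defect of \<open>e\<close>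
  enters only through its support: if \<open>e(x) \<noteq> 0\<close> then \<open>|C\<^sub>G(x)|\<close> is not divisible by \<open>p\<^sup>d\<^sup>+\<^sup>1\<close>.\<close>

section \<open>Sums over orbits in positive characteristic\<close>

text \<open>After restriction to C_G(u) and passage modulo u, the image of e is only a central
  idempotent: it may be zero or a sum of several block idempotents, and no defect group is at hand
  for it. Centralizer orders at points of the support do pass to subgroups and quotients by mere
  counting, and \<open>small_defect\<close> carries the induction in their place. The induction does
  not carry the exponent either. It runs with \<open>\<epsilon> = d\<close>, where p^d - p^(d -
  \<epsilon>) + 1 becomes p^d. The exponent of D enters only for G itself, by n \<le> \<epsilon> in
  (p^n - 1) p^(d - n) = p^d - p^(d - n). The summand 1 is the last nilpotent factor, which
  annihilates the invariant element w. The annihilation is a Frobenius argument: w is constant on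
  each set of elements with conjugate p'-parts, and the sum of suitable coefficients over such a set
  has a p-power that is a coefficient sum of the power of a nilpotent element. One principle yields
  most of the vanishing: in characteristic p, an invariant sum under a map of p-power period reduces
  to its fixed points.\<close>

lemma sum_fibres_eq_0:
  fixes f :: "'x \<Rightarrow> 'f::field"
  assumes "finite X"
    and card: "\<And>x. x \<in> X \<Longrightarrow> CHAR('f) dvd card {y \<in> X. c y = c x}"
    and inv: "\<And>x y. x \<in> X \<Longrightarrow> y \<in> X \<Longrightarrow> c y = c x \<Longrightarrow> f y = f x"
  shows "sum f X = 0"
proof -
  have "sum f X = (\<Sum>k\<in>c ` X. \<Sum>y\<in>{y\<in>X. c y = k}. f y)"
    by (rule sum.group[OF assms(1) finite_imageI[OF assms(1)] order_refl, symmetric])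
  also have "\<dots> = 0"
  proof (rule sum.neutral, rule ballI, erule imageE)
    fix k x assume x: "x \<in> X" and k: "k = c x"
    have "(\<Sum>y\<in>{y\<in>X. c y = c x}. f y) = (\<Sum>y\<in>{y\<in>X. c y = c x}. f x)"
      by (rule sum.cong[OF refl], rule inv[OF x]) simp_all
    also have "\<dots> = of_nat (card {y\<in>X. c y = c x}) * f x" by simp
    also have "\<dots> = 0" using card[OF x] by (simp add: of_nat_eq_0_iff_char_dvd)
    finally show "(\<Sum>y\<in>{y\<in>X. c y = k}. f y) = 0" unfolding k .
  qed
  finally show ?thesis .
qed

lemma funpow_mult_fix:
  assumes "(\<tau> ^^ n) x = x" shows "(\<tau> ^^ (k * n)) x = x"
  using assms by (induction k) (auto simp: funpow_add)

text \<open>Every orbit of \<open>\<tau>\<close> on X has 1 or p elements, p being prime; an orbit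
  of p elements contributes p times a single value, hence 0.\<close>

lemma sum_prime_period:
  fixes f :: "'x \<Rightarrow> 'f::field"
  assumes X: "finite X" and p: "prime p" "CHAR('f) = p"
    and t: "\<And>x. x \<in> X \<Longrightarrow> \<tau> x \<in> X" "\<And>x. x \<in> X \<Longrightarrow> (\<tau> ^^ p) x = x"
    and f: "\<And>x. x \<in> X \<Longrightarrow> f (\<tau> x) = f x"
  shows "sum f X = sum f {x \<in> X. \<tau> x = x}"
proof -
  define Y where "Y = {x \<in> X. \<tau> x \<noteq> x}"
  define orb where "orb x = (\<lambda>i. (\<tau> ^^ i) x) ` {..<p}" for x
  have p0: "p > 0" using p(1) prime_gt_0_nat by blast
  have iter: "(\<tau> ^^ i) x \<in> X \<and> f ((\<tau> ^^ i) x) = f x" if "x \<in> X" for i x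
    using that by (induction i) (auto simp: t f)
  \<comment> \<open>By Bezout, a period prime to p and the period p together give the period
    1.\<close>
  have fixed: "\<tau> x = x" if x: "x \<in> X" and m: "(\<tau> ^^ m) x = x" "coprime m p" for x m
  proof -
    have "m \<noteq> 0" using m(2) p(1) by (metis coprime_0_left_iff is_unit_gcd not_prime_unit)
    then obtain a b where "m * a = p * b + gcd m p"
      using bezout_nat[of m p] by blast
    then have "a * m = b * p + 1" using m(2) by (simp add: mult.commute)
    then have "(\<tau> ^^ (b * p + 1)) x = x" using funpow_mult_fix[OF m(1), of a] by simp
    then have "(\<tau> ^^ (b * p)) (\<tau> x) = x" by (simp flip: funpow_swap1)
    then show ?thesis using funpow_mult_fix[OF t(2)[OF t(1)[OF x]], of b] by simp
  qed
  have Yclosed: "(\<tau> ^^ i) x \<in> Y" if "x \<in> Y" for i x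
  proof (rule ccontr)
    assume neg: "(\<tau> ^^ i) x \<notin> Y"
    have x: "x \<in> X" using that by (simp add: Y_def)
    from neg have "\<tau> ((\<tau> ^^ i) x) = (\<tau> ^^ i) x" using iter[OF x] by (auto simp: Y_def)
    then have st: "(\<tau> ^^ j) ((\<tau> ^^ i) x) = (\<tau> ^^ i) x" for j
      by (induction j) auto
    \<comment> \<open>On X the iterate number i * p - i undoes the i-th one, so an orbit that
      reaches a fixed point consists of that point alone.\<close>
    have "(\<tau> ^^ (i * p - i + i)) x = (\<tau> ^^ i) x"
      unfolding funpow_add comp_apply by (rule st)
    moreover have "i * p - i + i = i * p" using p0 by simp
    ultimately have "(\<tau> ^^ i) x = x" using funpow_mult_fix[OF t(2)[OF x], of i] by simp
    then show False using st[of 1] that by (simp add: Y_def)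
  qed
  have inj: "inj_on (\<lambda>i. (\<tau> ^^ i) x) {..<p}" if x: "x \<in> Y" for x
  proof (rule linorder_inj_onI, goal_cases)
    case (1 i j)
    show ?case
    proof
      assume eq: "(\<tau> ^^ i) x = (\<tau> ^^ j) x"
      let ?y = "(\<tau> ^^ i) x"
      have "(\<tau> ^^ (j - i)) ?y = (\<tau> ^^ (j - i + i)) x" unfolding funpow_add comp_apply ..
      then have "(\<tau> ^^ (j - i)) ?y = ?y" using eq 1 by simp
      moreover have "coprime (j - i) p"
      proof -
        have "\<not> p dvd (j - i)" using 1 by (auto dest!: dvd_imp_le)
        then show ?thesis using p(1) prime_imp_coprime coprime_commute by blast
      qed
      ultimately have "\<tau> ?y = ?y" using fixed[of ?y] Yclosed[OF x, of i] by (auto simp: Y_def)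
      then show False using Yclosed[OF x, of i] by (auto simp: Y_def)
    qed
  qed auto
  have Ostep: "orb (\<tau> x) = orb x" if x: "x \<in> X" for x
  proof -
    have 1: "(\<tau> ^^ i) (\<tau> x) \<in> orb x" if "i < p" for i
    proof (cases "Suc i = p")
      case True
      then have "(\<tau> ^^ i) (\<tau> x) = (\<tau> ^^ 0) x" using t(2)[OF x] by (auto simp flip: funpow_swap1)
      then show ?thesis unfolding orb_def using p0 by blast
    next
      case False
      then have "(\<tau> ^^ i) (\<tau> x) = (\<tau> ^^ Suc i) x" "Suc i < p" using that by (auto simp flip: funpow_swap1)
      then show ?thesis unfolding orb_def by blast
    qed
    have 2: "(\<tau> ^^ i) x \<in> orb (\<tau> x)" if "i < p" for i
    proof (cases i)
      case 0
      have "(\<tau> ^^ (p - 1)) (\<tau> x) = (\<tau> ^^ Suc (p - 1)) x" unfolding funpow_Suc_right comp_apply ..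
      then have "(\<tau> ^^ (p - 1)) (\<tau> x) = x" using t(2)[OF x] p0 by simp
      then show ?thesis unfolding orb_def using p0 0 by (auto intro!: image_eqI[of _ _ "p - 1"])
    next
      case (Suc k)
      then show ?thesis unfolding orb_def using that by (auto intro!: image_eqI[of _ _ k] simp flip: funpow_swap1)
    qed
    have "orb (\<tau> x) \<subseteq> orb x" unfolding orb_def[of "\<tau> x"] using 1 by (intro image_subsetI) simp
    moreover have "orb x \<subseteq> orb (\<tau> x)" unfolding orb_def[of x] using 2 by (intro image_subsetI) simp
    ultimately show ?thesis ..
  qed
  have Oit: "orb ((\<tau> ^^ i) x) = orb x" if "x \<in> X" for i x
    using that by (induction i) (auto simp: Ostep iter)
  have self: "x \<in> orb x" for x unfolding orb_def using p0 by (auto intro!: image_eqI[of _ _ 0])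
  have fib: "{y \<in> Y. orb y = orb x} = orb x" if x: "x \<in> Y" for x
  proof (intro equalityI subsetI)
    fix y assume "y \<in> {y \<in> Y. orb y = orb x}" then show "y \<in> orb x" using self[of y] by auto
  next
    fix y assume "y \<in> orb x"
    then obtain i where "y = (\<tau> ^^ i) x" unfolding orb_def by auto
    moreover have "x \<in> X" using x by (simp add: Y_def)
    ultimately show "y \<in> {y \<in> Y. orb y = orb x}" using Yclosed[OF x, of i] Oit[of x] by simp
  qed
  have "sum f Y = 0"
  proof (rule sum_fibres_eq_0[where c = orb])
    show "finite Y" using X by (simp add: Y_def)
    show "CHAR('f) dvd card {y \<in> Y. orb y = orb x}" if "x \<in> Y" for x
    proof -
      have "card (orb x) = p" using card_image[OF inj[OF that]] by (simp add: orb_def)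
      then show ?thesis using fib[OF that] p(2) by simp
    qed
    show "f y = f x" if "x \<in> Y" "y \<in> Y" "orb y = orb x" for x y
    proof -
      have "y \<in> orb x" using self[of y] that by simp
      then obtain i where "y = (\<tau> ^^ i) x" unfolding orb_def by auto
      then show ?thesis using iter[of x i] that by (auto simp: Y_def)
    qed
  qed
  moreover have "sum f X = sum f Y + sum f {x \<in> X. \<tau> x = x}"
  proof -
    have "X = Y \<union> {x \<in> X. \<tau> x = x}" "Y \<inter> {x \<in> X. \<tau> x = x} = {}" by (auto simp: Y_def)
    then show ?thesis using sum.union_disjoint[of Y "{x \<in> X. \<tau> x = x}" f] X by (simp add: Y_def)
  qed
  ultimately show ?thesis by simp
qed

text \<open>One factor p is removed at a time: \<open>\<sigma> ^^ (p ^ k)\<close> has period p, and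
  on its fixed points \<open>\<sigma>\<close> has period p ^ k. The lemma is applied below to
  conjugation, to translation within a coset, to rotation of tuples and to the action of a p-element
  on the cosets of D.\<close>

lemma sum_prime_power_period:
  fixes f :: "'x \<Rightarrow> 'f::field"
  assumes "finite X" and p: "prime p" "CHAR('f) = p"
    and "\<And>x. x \<in> X \<Longrightarrow> \<sigma> x \<in> X" "\<And>x. x \<in> X \<Longrightarrow> (\<sigma> ^^ (p ^ k)) x = x"
    and "\<And>x. x \<in> X \<Longrightarrow> f (\<sigma> x) = f x"
  shows "sum f X = sum f {x \<in> X. \<sigma> x = x}"
  using assms(1,4,5,6)
proof (induction k arbitrary: X)
  case 0
  then have "{x \<in> X. \<sigma> x = x} = X" by auto
  then show ?case by simp
next
  case (Suc k)
  define \<tau> where "\<tau> = \<sigma> ^^ (p ^ k)"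
  define Y where "Y = {x \<in> X. \<tau> x = x}"
  have iter: "(\<sigma> ^^ i) x \<in> X \<and> f ((\<sigma> ^^ i) x) = f x" if "x \<in> X" for i x
    using that by (induction i) (auto simp: Suc.prems)
  have "(\<tau> ^^ p) x = x" if "x \<in> X" for x
    using Suc.prems(3)[OF that] by (simp add: \<tau>_def funpow_mult mult.commute)
  then have "sum f X = sum f Y" unfolding Y_def
    using sum_prime_period[of X p \<tau> f] Suc.prems(1) p iter by (auto simp: \<tau>_def)
  also have "\<dots> = sum f {x \<in> Y. \<sigma> x = x}"
  proof (rule Suc.IH)
    fix x assume "x \<in> Y"
    then show "\<sigma> x \<in> Y" using Suc.prems(2) by (auto simp: Y_def \<tau>_def simp flip: funpow_swap1)
  next
    show "finite Y" using Suc.prems(1) by (simp add: Y_def)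
    show "\<And>x. x \<in> Y \<Longrightarrow> (\<sigma> ^^ p ^ k) x = x" by (simp add: Y_def \<tau>_def)
    show "\<And>x. x \<in> Y \<Longrightarrow> f (\<sigma> x) = f x" using Suc.prems(4) by (simp add: Y_def)
  qed
  also have "{x \<in> Y. \<sigma> x = x} = {x \<in> X. \<sigma> x = x}"
  proof -
    have "(\<sigma> ^^ i) x = x" if "\<sigma> x = x" for i x using that by (induction i) auto
    then show ?thesis by (auto simp: Y_def \<tau>_def)
  qed
  finally show ?case .
qed

section \<open>The group algebra\<close>

locale fin_group = group G for G (structure) +
  assumes fin [simp]: "finite (carrier G)"
begin

lemma sum_translate_left:
  "t \<in> carrier G \<Longrightarrow> (\<Sum>y\<in>carrier G. h (t \<otimes> y)) = (\<Sum>y\<in>carrier G. h y)"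
  by (rule sum.reindex_bij_witness[of _ "\<lambda>y. inv t \<otimes> y" "\<lambda>y. t \<otimes> y"])
    (auto simp: m_assoc[symmetric])

lemma sum_inv: "(\<Sum>y\<in>carrier G. h (inv y)) = (\<Sum>y\<in>carrier G. h y)"
  by (rule sum.reindex_bij_witness[of _ "\<lambda>y. inv y" "\<lambda>y. inv y"]) auto

abbreviation gmult (infixr "\<star>" 70) where "a \<star> b \<equiv> ga_mult G a b"

lemma ga_mult_closed [simp]: "a \<star> b \<in> grp_alg G"
  by (simp add: grp_alg_def ga_mult_def)

lemma ga_mult_apply:
  "x \<in> carrier G \<Longrightarrow> (a \<star> b) x = (\<Sum>y\<in>carrier G. a y * b (inv y \<otimes> x))"
  by (simp add: ga_mult_def)

lemma grp_alg_eqI: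
  "a \<in> grp_alg G \<Longrightarrow> b \<in> grp_alg G \<Longrightarrow> (\<And>x. x \<in> carrier G \<Longrightarrow> a x = b x) \<Longrightarrow> a = b"
  by (rule ext) (metis (mono_tags, lifting) grp_alg_def mem_Collect_eq)

lemma ga_mult_assoc: "(a \<star> b) \<star> c = a \<star> (b \<star> c)"
proof (rule grp_alg_eqI)
  fix x assume x: "x \<in> carrier G"
  have "((a \<star> b) \<star> c) x
      = (\<Sum>y\<in>carrier G. \<Sum>t\<in>carrier G. a t * (b (inv t \<otimes> y) * c (inv y \<otimes> x)))"
    by (simp add: ga_mult_apply x sum_distrib_right mult.assoc)
  also have "\<dots> = (\<Sum>t\<in>carrier G. a t * (\<Sum>y\<in>carrier G. b (inv t \<otimes> y) * c (inv y \<otimes> x)))"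
    by (subst sum.swap) (simp add: sum_distrib_left)
  also have "\<dots> = (\<Sum>t\<in>carrier G. a t * (\<Sum>s\<in>carrier G. b s * c (inv s \<otimes> (inv t \<otimes> x))))"
  proof (rule sum.cong[OF refl])
    fix t assume t: "t \<in> carrier G"
    have "(\<Sum>y\<in>carrier G. b (inv t \<otimes> y) * c (inv y \<otimes> x))
        = (\<Sum>s\<in>carrier G. b (inv t \<otimes> (t \<otimes> s)) * c (inv (t \<otimes> s) \<otimes> x))"
      by (rule sum_translate_left[OF t, symmetric])
    also have "\<dots> = (\<Sum>s\<in>carrier G. b s * c (inv s \<otimes> (inv t \<otimes> x)))"
      by (rule sum.cong[OF refl]) (simp add: t x inv_mult_group m_assoc flip: m_assoc[of "inv t" t])
    finally show "a t * (\<Sum>y\<in>carrier G. b (inv t \<otimes> y) * c (inv y \<otimes> x))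
        = a t * (\<Sum>s\<in>carrier G. b s * c (inv s \<otimes> (inv t \<otimes> x)))" by simp
  qed
  also have "\<dots> = (a \<star> (b \<star> c)) x"
    by (simp add: ga_mult_apply x)
  finally show "((a \<star> b) \<star> c) x = (a \<star> (b \<star> c)) x" .
qed simp_all

lemma ga_zero_in [simp]: "ga_zero \<in> grp_alg G"
  by (simp add: grp_alg_def ga_zero_def)

lemma ga_mult_zero [simp]: "a \<star> ga_zero = ga_zero" "ga_zero \<star> a = ga_zero"
  by (simp_all add: ga_mult_def ga_zero_def fun_eq_iff)

definition single :: "'a \<Rightarrow> 'a \<Rightarrow> 'f::field" where
  "single g = (\<lambda>x. if x = g then 1 else 0)"

lemma single_in [simp]: "g \<in> carrier G \<Longrightarrow> single g \<in> grp_alg G"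
  by (auto simp: grp_alg_def single_def)

lemma mult_single:
  assumes "g \<in> carrier G" "x \<in> carrier G"
  shows "(a \<star> single g) x = a (x \<otimes> inv g)"
proof -
  have "(inv y \<otimes> x = g) = (y = x \<otimes> inv g)" if "y \<in> carrier G" for y
    using that assms by (metis inv_closed inv_solve_left inv_solve_right)
  then have "(a \<star> single g) x = (\<Sum>y\<in>carrier G. if y = x \<otimes> inv g then a y else 0)"
    unfolding ga_mult_apply[OF assms(2)] by (intro sum.cong) (auto simp: single_def)
  then show ?thesis using assms by (simp add: sum.delta)
qed

lemma single_mult:
  assumes "g \<in> carrier G" "x \<in> carrier G"
  shows "(single g \<star> a) x = a (inv g \<otimes> x)"
proof -
  have "(single g \<star> a) x = (\<Sum>y\<in>carrier G. if y = g then a (inv y \<otimes> x) else 0)"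
    unfolding ga_mult_apply[OF assms(2)] by (intro sum.cong) (auto simp: single_def)
  then show ?thesis using assms by (simp add: sum.delta)
qed

end

section \<open>Central elements as class functions\<close>

definition class_fun :: "('g,'b) monoid_scheme \<Rightarrow> ('g \<Rightarrow> 'f::field) \<Rightarrow> bool" where
  "class_fun G z \<longleftrightarrow> z \<in> grp_alg G \<and>
     (\<forall>x\<in>carrier G. \<forall>y\<in>carrier G. z (x \<otimes>\<^bsub>G\<^esub> y) = z (y \<otimes>\<^bsub>G\<^esub> x))"

text \<open>The n-th iterate started at z is the power z^(n+1). Starting at z instead of a unit lets
  multiplicative maps such as \<open>restr\<close> and \<open>push\<close> transport nilpotency
  without reference to unit elements.\<close>

definition ga_nilpotent :: "('g,'b) monoid_scheme \<Rightarrow> ('g \<Rightarrow> 'f::field) \<Rightarrow> bool" where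
  "ga_nilpotent G z \<longleftrightarrow> (\<exists>n. (ga_mult G z ^^ n) z = ga_zero)"

context fin_group
begin

lemma class_fun_in: "class_fun G z \<Longrightarrow> z \<in> grp_alg G"
  by (simp add: class_fun_def)

lemma class_fun_swap:
  "class_fun G z \<Longrightarrow> x \<in> carrier G \<Longrightarrow> y \<in> carrier G \<Longrightarrow> z (x \<otimes> y) = z (y \<otimes> x)"
  by (simp add: class_fun_def)

lemma class_fun_conj:
  assumes "class_fun G z" "g \<in> carrier G" "x \<in> carrier G"
  shows "z (g \<otimes> x \<otimes> inv g) = z x" "z (inv g \<otimes> x \<otimes> g) = z x"
  using class_fun_swap[OF assms(1), of "g \<otimes> x" "inv g"] class_fun_swap[OF assms(1), of "inv g \<otimes> x" g] assms
  by (simp_all flip: m_assoc)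

lemma class_fun_commute:
  assumes "class_fun G z"
  shows "z \<star> b = b \<star> z"
proof (rule grp_alg_eqI)
  fix x assume x: "x \<in> carrier G"
  define h where "h y = z y * b (inv y \<otimes> x)" for y
  have "(z \<star> b) x = (\<Sum>y\<in>carrier G. h y)"
    by (simp add: ga_mult_apply x h_def)
  \<comment> \<open>The substitution y -> x * inv y exchanges the two factors of the
    convolution.\<close>
  also have "\<dots> = (\<Sum>y\<in>carrier G. h (x \<otimes> inv y))"
    using sum_inv[of "\<lambda>y. h (x \<otimes> y)"] sum_translate_left[OF x, of h] by simp
  also have "\<dots> = (b \<star> z) x"
    unfolding ga_mult_apply[OF x]
  proof (rule sum.cong[OF refl])
    fix y assume y: "y \<in> carrier G"
    have "inv (x \<otimes> inv y) \<otimes> x = y"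
      using x y by (simp add: inv_mult_group m_assoc)
    then show "h (x \<otimes> inv y) = b y * z (inv y \<otimes> x)"
      using x y by (simp add: h_def class_fun_swap[OF assms, of x] mult.commute)
  qed
  finally show "(z \<star> b) x = (b \<star> z) x" .
qed simp_all

lemma class_funI:
  assumes "z \<in> grp_alg G" "\<And>b. b \<in> grp_alg G \<Longrightarrow> z \<star> b = b \<star> z"
  shows "class_fun G z"
  unfolding class_fun_def
proof (intro conjI ballI assms)
  fix x y assume xy: "x \<in> carrier G" "y \<in> carrier G"
  have "(z \<star> single (inv y)) x = (single (inv y) \<star> z) x"
    using assms(2)[of "single (inv y)"] xy by simp
  then show "z (x \<otimes> y) = z (y \<otimes> x)"
    using xy by (simp add: mult_single single_mult)
qed

lemma class_fun_mult:
  assumes "class_fun G a" "class_fun G b"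
  shows "class_fun G (a \<star> b)"
proof (rule class_funI)
  fix c
  have "(a \<star> b) \<star> c = a \<star> (c \<star> b)"
    by (simp add: ga_mult_assoc class_fun_commute[OF assms(2), of c])
  also have "\<dots> = c \<star> a \<star> b"
    by (simp add: class_fun_commute[OF assms(1), of c] flip: ga_mult_assoc)
  finally show "(a \<star> b) \<star> c = c \<star> a \<star> b" .
qed simp

lemma class_fun_prod:
  "\<forall>z\<in>set zs. class_fun G z \<Longrightarrow> class_fun G e \<Longrightarrow> class_fun G (foldr (\<star>) zs e)"
  by (induction zs) (auto intro: class_fun_mult)

lemma prod_mult_right: "foldr (\<star>) zs (a \<star> b) = foldr (\<star>) zs a \<star> b"
  by (induction zs) (simp_all add: ga_mult_assoc)

text \<open>Since e is a central idempotent it can be duplicated, so a long product cuts into pieces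
  each of which contains e and can be estimated on its own.\<close>

lemma prod_append_idem:
  assumes "\<forall>z\<in>set ws. class_fun G z" "class_fun G e" "e \<star> e = e"
  shows "foldr (\<star>) (zs @ ws) e = foldr (\<star>) zs e \<star> foldr (\<star>) ws e"
proof -
  have "foldr (\<star>) ws e = foldr (\<star>) ws e \<star> e"
    using prod_mult_right[of ws e e] assms(3) by simp
  also have "\<dots> = e \<star> foldr (\<star>) ws e"
    by (rule class_fun_commute[OF class_fun_prod]) (use assms in auto)
  finally show ?thesis using prod_mult_right[of zs e "foldr (\<star>) ws e"] by simp
qed

lemma pow_mult_right: "(ga_mult G z ^^ n) (a \<star> b) = (ga_mult G z ^^ n) a \<star> b"
  by (induction n) (simp_all add: ga_mult_assoc)

lemma pow_commute:
  assumes "class_fun G z"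
  shows "(ga_mult G z ^^ n) (a \<star> b) = a \<star> (ga_mult G z ^^ n) b"
proof (induction n)
  case (Suc n)
  then show ?case
    by (simp add: class_fun_commute[OF assms, of a] flip: ga_mult_assoc)
qed simp

end

section \<open>Restriction to subgroups and centralizers\<close>

definition centralizer_of :: "('g,'b) monoid_scheme \<Rightarrow> 'g \<Rightarrow> 'g set" where
  "centralizer_of G x = {g \<in> carrier G. g \<otimes>\<^bsub>G\<^esub> x = x \<otimes>\<^bsub>G\<^esub> g}"

definition restr :: "'g set \<Rightarrow> ('g \<Rightarrow> 'f::field) \<Rightarrow> 'g \<Rightarrow> 'f" where
  "restr H a = (\<lambda>x. if x \<in> H then a x else 0)"

abbreviation restr_grp :: "('g,'b) monoid_scheme \<Rightarrow> 'g set \<Rightarrow> ('g,'b) monoid_scheme" where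
  "restr_grp G H \<equiv> G\<lparr>carrier := H\<rparr>"

context fin_group
begin

lemma subgroup_centralizer_of: "x \<in> carrier G \<Longrightarrow> subgroup (centralizer_of G x) G"
proof (rule subgroupI)
  assume x: "x \<in> carrier G"
  show "centralizer_of G x \<subseteq> carrier G" by (auto simp: centralizer_of_def)
  show "centralizer_of G x \<noteq> {}" using x by (auto simp: centralizer_of_def)
  show "inv a \<in> centralizer_of G x" if "a \<in> centralizer_of G x" for a
  proof -
    from that have a: "a \<in> carrier G" "a \<otimes> x = x \<otimes> a" by (auto simp: centralizer_of_def)
    have "inv a \<otimes> x = x \<otimes> inv a"
      using a x by (metis inv_closed inv_solve_left inv_solve_right m_assoc m_closed)
    then show ?thesis using a by (simp add: centralizer_of_def)
  qed
  show "a \<otimes> b \<in> centralizer_of G x" if "a \<in> centralizer_of G x" "b \<in> centralizer_of G x" for a b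
    using that x unfolding centralizer_of_def by (metis (mono_tags, lifting) m_assoc m_closed mem_Collect_eq)
qed

lemma fin_group_restr: "subgroup H G \<Longrightarrow> fin_group (restr_grp G H)"
  by (auto simp: fin_group_def fin_group_axioms_def subgroup_imp_group
      intro: finite_subset[OF subgroup.subset])

lemma class_fun_restr:
  "subgroup H G \<Longrightarrow> class_fun G z \<Longrightarrow> class_fun (restr_grp G H) (restr H z)"
  by (auto simp: class_fun_def grp_alg_def restr_def subgroup.m_closed subgroup.mem_carrier)

text \<open>The restriction to the centralizer of a \<open>p\<close>-element is the Brauer homomorphism.\<close>

lemma restr_centralizer_mult:
  fixes a b :: "'a \<Rightarrow> 'f::field"
  assumes p: "prime p" "CHAR('f) = p"
    and u: "u \<in> carrier G" "u [^] (p ^ k) = \<one>"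
    and ab: "class_fun G a" "class_fun G b"
  defines "C \<equiv> centralizer_of G u"
  shows "restr C (a \<star> b) = ga_mult (restr_grp G C) (restr C a) (restr C b)"
proof (rule ext)
  fix x
  have C: "subgroup C G" unfolding C_def by (rule subgroup_centralizer_of[OF u(1)])
  show "restr C (a \<star> b) x = ga_mult (restr_grp G C) (restr C a) (restr C b) x"
  proof (cases "x \<in> C")
    case True
    then have x: "x \<in> carrier G" and ux: "x \<otimes> u = u \<otimes> x" unfolding C_def centralizer_of_def by blast+
    define f where "f y = a y * b (inv y \<otimes> x)" for y
    \<comment> \<open>Conjugation by u fixes x and preserves both class functions, so it permutes
      equal summands of the convolution at x. Its fixed points form C.\<close>
    define \<sigma> where "\<sigma> y = u \<otimes> y \<otimes> inv u" for y
    have pow: "(\<sigma> ^^ n) y = u [^] n \<otimes> y \<otimes> inv (u [^] n)" if "y \<in> carrier G" for n y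
      using that
    proof (induction n)
      case (Suc n)
      have "u [^] Suc n = u \<otimes> u [^] n" by (rule nat_pow_Suc2[OF u(1)])
      then show ?case using Suc u(1) by (simp add: \<sigma>_def inv_mult_group m_assoc)
    qed (simp add: u)
    have fix_iff: "\<sigma> y = y \<longleftrightarrow> u \<otimes> y = y \<otimes> u" if "y \<in> carrier G" for y
      using that u(1) unfolding \<sigma>_def by (metis inv_solve_right' m_closed)
    have f: "f (\<sigma> y) = f y" if y: "y \<in> carrier G" for y
    proof -
      have "inv (\<sigma> y) \<otimes> x = u \<otimes> inv y \<otimes> inv u \<otimes> x"
        using y u(1) by (simp add: \<sigma>_def inv_mult_group m_assoc)
      also have "\<dots> = u \<otimes> (inv y \<otimes> x) \<otimes> inv u"
      proof -
        have "inv u \<otimes> x = x \<otimes> inv u"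
          using ux u(1) x by (metis inv_closed inv_solve_left inv_solve_right m_assoc m_closed)
        then show ?thesis using y u(1) x by (simp add: m_assoc)
      qed
      finally show ?thesis
        using y u(1) x by (simp add: f_def class_fun_conj[OF ab(2)]) (simp add: \<sigma>_def class_fun_conj[OF ab(1)])
    qed
    have "(a \<star> b) x = sum f (carrier G)" by (simp add: ga_mult_apply x f_def)
    also have "\<dots> = sum f {y \<in> carrier G. \<sigma> y = y}"
    proof (rule sum_prime_power_period[OF fin p, where k = k])
      show "\<sigma> y \<in> carrier G" if "y \<in> carrier G" for y
        using that u(1) by (simp add: \<sigma>_def)
      show "(\<sigma> ^^ (p ^ k)) y = y" if "y \<in> carrier G" for y
        using pow[OF that, of "p ^ k"] that u(2) by simp
    qed (rule f)
    also have "{y \<in> carrier G. \<sigma> y = y} = C"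
      using fix_iff by (auto simp: C_def centralizer_of_def)
    also have "sum f C = ga_mult (restr_grp G C) (restr C a) (restr C b) x"
      unfolding ga_mult_def using True
      by (auto intro!: sum.cong simp: f_def restr_def m_inv_consistent[OF C]
          subgroup.m_closed[OF C] subgroup.m_inv_closed[OF C])
    finally show ?thesis using True by (simp add: restr_def)
  qed (simp add: restr_def ga_mult_def)
qed

end

section \<open>The map of group algebras induced by a surjective homomorphism\<close>

definition push :: "('g,'b) monoid_scheme \<Rightarrow> ('h,'c) monoid_scheme \<Rightarrow> ('g \<Rightarrow> 'h) \<Rightarrow> ('g \<Rightarrow> 'f::field) \<Rightarrow> 'h \<Rightarrow> 'f" where
  "push H Q \<phi> a = (\<lambda>q. if q \<in> carrier Q then \<Sum>x\<in>{x\<in>carrier H. \<phi> x = q}. a x else 0)"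

locale fin_group_surj = H: fin_group H + Q: fin_group Q for H (structure) and Q (structure) +
  fixes \<phi>
  assumes hom: "\<phi> \<in> hom H Q" and surj: "\<phi> ` carrier H = carrier Q"
begin

sublocale group_hom H Q \<phi>
  by unfold_locales (rule hom)

lemma push_apply: "q \<in> carrier Q \<Longrightarrow> push H Q \<phi> a q = (\<Sum>x\<in>{x\<in>carrier H. \<phi> x = q}. a x)"
  by (simp add: push_def)

lemma push_in [simp]: "push H Q \<phi> a \<in> grp_alg Q"
  by (simp add: push_def grp_alg_def)

lemma sum_over_fibres:
  "(\<Sum>q\<in>carrier Q. \<Sum>x\<in>{x\<in>carrier H. \<phi> x = q}. h x) = sum h (carrier H)"
  by (rule sum.group) (use surj in auto)

lemma sum_fibre_translate:
  assumes y: "y \<in> carrier H" and q: "q \<in> carrier Q"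
  shows "(\<Sum>x\<in>{x\<in>carrier H. \<phi> x = q}. h (inv\<^bsub>H\<^esub> y \<otimes>\<^bsub>H\<^esub> x))
    = (\<Sum>x\<in>{x\<in>carrier H. \<phi> x = inv\<^bsub>Q\<^esub> (\<phi> y) \<otimes>\<^bsub>Q\<^esub> q}. h x)"
  by (rule sum.reindex_bij_witness[of _ "\<lambda>x. y \<otimes>\<^bsub>H\<^esub> x" "\<lambda>x. inv\<^bsub>H\<^esub> y \<otimes>\<^bsub>H\<^esub> x"])
    (use y q in \<open>auto simp flip: H.m_assoc Q.m_assoc\<close>)

lemma push_mult: "push H Q \<phi> (ga_mult H a b) = ga_mult Q (push H Q \<phi> a) (push H Q \<phi> b)"
proof (rule Q.grp_alg_eqI)
  fix q assume q: "q \<in> carrier Q"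
  have "push H Q \<phi> (ga_mult H a b) q
      = (\<Sum>y\<in>carrier H. \<Sum>x\<in>{x\<in>carrier H. \<phi> x = q}. a y * b (inv\<^bsub>H\<^esub> y \<otimes>\<^bsub>H\<^esub> x))"
    by (subst sum.swap) (simp add: push_apply q H.ga_mult_apply)
  also have "\<dots> = (\<Sum>y\<in>carrier H. a y * push H Q \<phi> b (inv\<^bsub>Q\<^esub> (\<phi> y) \<otimes>\<^bsub>Q\<^esub> q))"
    by (rule sum.cong[OF refl])
      (simp add: push_apply q sum_fibre_translate[OF _ q] flip: sum_distrib_left)
  also have "\<dots> = (\<Sum>r\<in>carrier Q. \<Sum>y\<in>{y\<in>carrier H. \<phi> y = r}.
      a y * push H Q \<phi> b (inv\<^bsub>Q\<^esub> (\<phi> y) \<otimes>\<^bsub>Q\<^esub> q))"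
    by (rule sum_over_fibres[symmetric])
  also have "\<dots> = ga_mult Q (push H Q \<phi> a) (push H Q \<phi> b) q"
    by (simp add: Q.ga_mult_apply q push_apply[of _ a] sum_distrib_right)
  finally show "push H Q \<phi> (ga_mult H a b) q = ga_mult Q (push H Q \<phi> a) (push H Q \<phi> b) q" .
qed simp_all

text \<open>Conjugation by a preimage x of q carries the fibre over q r bijectively to the fibre
  over r q without changing the values of z.\<close>

lemma push_class_fun:
  assumes "class_fun H z"
  shows "class_fun Q (push H Q \<phi> z)"
  unfolding class_fun_def
proof (intro conjI ballI)
  fix q r assume qr: "q \<in> carrier Q" "r \<in> carrier Q"
  then obtain x where x: "x \<in> carrier H" "\<phi> x = q" using surj by (metis imageE)
  have 1: "inv\<^bsub>Q\<^esub> q \<otimes>\<^bsub>Q\<^esub> (q \<otimes>\<^bsub>Q\<^esub> r) \<otimes>\<^bsub>Q\<^esub> q = r \<otimes>\<^bsub>Q\<^esub> q"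
    using qr by (simp flip: Q.m_assoc)
  have 2: "q \<otimes>\<^bsub>Q\<^esub> (r \<otimes>\<^bsub>Q\<^esub> q) \<otimes>\<^bsub>Q\<^esub> inv\<^bsub>Q\<^esub> q = q \<otimes>\<^bsub>Q\<^esub> r"
    using qr by (simp add: Q.m_assoc)
  have 3: "inv\<^bsub>Q\<^esub> q \<otimes>\<^bsub>Q\<^esub> (q \<otimes>\<^bsub>Q\<^esub> r) = r"
    using qr by (simp flip: Q.m_assoc)
  have conj: "x \<otimes>\<^bsub>H\<^esub> (inv\<^bsub>H\<^esub> x \<otimes>\<^bsub>H\<^esub> t \<otimes>\<^bsub>H\<^esub> x) \<otimes>\<^bsub>H\<^esub> inv\<^bsub>H\<^esub> x = t"
    "inv\<^bsub>H\<^esub> x \<otimes>\<^bsub>H\<^esub> (x \<otimes>\<^bsub>H\<^esub> t \<otimes>\<^bsub>H\<^esub> inv\<^bsub>H\<^esub> x) \<otimes>\<^bsub>H\<^esub> x = t" if "t \<in> carrier H" for t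
    using that x by (simp_all add: H.m_assoc) (simp_all flip: H.m_assoc)
  have "(\<Sum>t\<in>{t\<in>carrier H. \<phi> t = q \<otimes>\<^bsub>Q\<^esub> r}. z t) = (\<Sum>t\<in>{t\<in>carrier H. \<phi> t = r \<otimes>\<^bsub>Q\<^esub> q}. z t)"
    by (rule sum.reindex_bij_witness[of _ "\<lambda>t. x \<otimes>\<^bsub>H\<^esub> t \<otimes>\<^bsub>H\<^esub> inv\<^bsub>H\<^esub> x" "\<lambda>t. inv\<^bsub>H\<^esub> x \<otimes>\<^bsub>H\<^esub> t \<otimes>\<^bsub>H\<^esub> x"])
      (use x qr in \<open>auto simp: 1[unfolded x(2)[symmetric]] 2[unfolded x(2)[symmetric]] 3[unfolded x(2)[symmetric]] conj H.class_fun_conj[OF assms]\<close>)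
  then show "push H Q \<phi> z (q \<otimes>\<^bsub>Q\<^esub> r) = push H Q \<phi> z (r \<otimes>\<^bsub>Q\<^esub> q)"
    using qr by (simp add: push_apply)
qed simp

end

text \<open>In j * C(p^n, j) = p^n * C(p^n - 1, j - 1), a binomial coefficient prime to p on the
  left would force p^n to divide j.\<close>

lemma prime_dvd_prime_power_choose:
  fixes p :: nat
  assumes "prime p" "0 < j" "j < p ^ n"
  shows "p dvd (p ^ n choose j)"
proof (rule ccontr)
  assume "\<not> p dvd (p ^ n choose j)"
  then have "coprime (p ^ n) (p ^ n choose j)"
    using assms(1) by (simp add: prime_imp_coprime)
  moreover have "p ^ n dvd j * (p ^ n choose j)"
    using times_binomial_minus1_eq[OF assms(2), of "p ^ n"] by simp
  ultimately have "p ^ n dvd j" using coprime_dvd_mult_left_iff by blast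
  then show False using assms by (auto dest: dvd_imp_le)
qed

section \<open>Translation by a central element\<close>

context fin_group
begin

text \<open>For a in FG this is (u^-1 - 1) a. If u is central of order p^n, then membership in the
  ideal generated by (u - 1)^k is the same as annihilation by (u - 1)^(p^n - k); the proof works
  with the second form throughout and thus needs no quotients by powers of u - 1.\<close>

definition shift_diff :: "'a \<Rightarrow> ('a \<Rightarrow> 'f::field) \<Rightarrow> 'a \<Rightarrow> 'f" where
  "shift_diff u a = (\<lambda>x. if x \<in> carrier G then a (u \<otimes> x) - a x else 0)"

lemma shift_diff_in [simp]: "shift_diff u a \<in> grp_alg G"
  by (simp add: shift_diff_def grp_alg_def)

lemma shift_diff_pow_in: "a \<in> grp_alg G \<Longrightarrow> (shift_diff u ^^ n) a \<in> grp_alg G"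
  by (cases n) auto

lemma shift_diff_mult:
  assumes u: "u \<in> carrier G" "\<And>x. x \<in> carrier G \<Longrightarrow> u \<otimes> x = x \<otimes> u"
  shows "shift_diff u (a \<star> b) = a \<star> shift_diff u b"
proof (rule grp_alg_eqI)
  fix x assume x: "x \<in> carrier G"
  have "inv y \<otimes> (u \<otimes> x) = u \<otimes> (inv y \<otimes> x)" if "y \<in> carrier G" for y
    using that x u(1) u(2)[of "inv y"] by (simp flip: m_assoc)
  then show "shift_diff u (a \<star> b) x = (a \<star> shift_diff u b) x"
    using u(1) x by (simp add: shift_diff_def ga_mult_apply right_diff_distrib sum_subtractf)
qed simp_all

lemma shift_diff_pow_mult:
  assumes "u \<in> carrier G" "\<And>x. x \<in> carrier G \<Longrightarrow> u \<otimes> x = x \<otimes> u"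
  shows "(shift_diff u ^^ n) (a \<star> b) = a \<star> (shift_diff u ^^ n) b"
  by (induction n) (simp_all add: shift_diff_mult[OF assms])

text \<open>Translation by u is the identity plus \<open>shift_diff u\<close>, so its m-th power is
  expanded by the binomial theorem; the induction step is Pascal's rule.\<close>

lemma shift_diff_binomial:
  assumes u: "u \<in> carrier G" and "x \<in> carrier G"
  shows "a (u [^] m \<otimes> x) = (\<Sum>j\<le>m. of_nat (m choose j) * (shift_diff u ^^ j) a x)"
  using assms(2)
proof (induction m arbitrary: x)
  case (Suc m)
  define f where "f j = (shift_diff u ^^ j) a x" for j
  have "a (u [^] Suc m \<otimes> x) = a (u [^] m \<otimes> (u \<otimes> x))"
    using u Suc.prems by (simp add: m_assoc)
  also have "\<dots> = (\<Sum>j\<le>m. of_nat (m choose j) * (shift_diff u ^^ j) a (u \<otimes> x))"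
    by (rule Suc.IH) (use u Suc.prems in simp)
  also have "\<dots> = (\<Sum>j\<le>m. of_nat (m choose j) * (f j + f (Suc j)))"
    by (rule sum.cong) (simp_all add: f_def shift_diff_def Suc.prems)
  also have "\<dots> = (\<Sum>j\<le>m. of_nat (m choose j) * f j) + (\<Sum>j\<le>m. of_nat (m choose j) * f (Suc j))"
    by (simp add: distrib_left sum.distrib)
  also have "(\<Sum>j\<le>m. of_nat (m choose j) * f j) = (\<Sum>j\<le>Suc m. of_nat (m choose j) * f j)"
    by (simp add: binomial_eq_0)
  also have "\<dots> = f 0 + (\<Sum>j\<le>m. of_nat (m choose Suc j) * f (Suc j))"
    by (subst sum.atMost_Suc_shift) simp
  also have "\<dots> + (\<Sum>j\<le>m. of_nat (m choose j) * f (Suc j))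
      = (\<Sum>j\<le>Suc m. of_nat (Suc m choose j) * f j)"
    by (subst sum.atMost_Suc_shift) (simp add: sum.distrib algebra_simps)
  finally show ?case by (simp add: f_def)
qed simp

text \<open>This is (u^-1 - 1)^(p^n) = u^(-p^n) - 1 = 0: the binomial coefficients strictly between
  the ends vanish in characteristic p.\<close>

lemma shift_diff_pow_eq_0:
  fixes a :: "'a \<Rightarrow> 'f::field"
  assumes p: "prime p" "CHAR('f) = p"
    and u: "u \<in> carrier G" "u [^] (p ^ n) = \<one>" and a: "a \<in> grp_alg G"
  shows "(shift_diff u ^^ (p ^ n)) a = ga_zero"
proof (rule grp_alg_eqI)
  fix x assume x: "x \<in> carrier G"
  define f where "f j = (of_nat (p ^ n choose j) :: 'f) * (shift_diff u ^^ j) a x" for j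
  have q: "p ^ n > 0" using p(1) prime_gt_0_nat by simp
  have "a x = sum f {..p ^ n}"
    using shift_diff_binomial[OF u(1) x, of a "p ^ n"] x by (simp add: u f_def)
  also have "\<dots> = sum f {0, p ^ n}"
  proof (rule sum.mono_neutral_right)
    have "f j = 0" if "0 < j" "j < p ^ n" for j
    proof -
      have "(of_nat (p ^ n choose j) :: 'f) = 0"
        using prime_dvd_prime_power_choose[OF p(1) that] p(2) by (simp add: of_nat_eq_0_iff_char_dvd)
      then show ?thesis by (simp add: f_def)
    qed
    then show "\<forall>i\<in>{..p ^ n} - {0, p ^ n}. f i = 0" by auto
  qed auto
  also have "\<dots> = a x + (shift_diff u ^^ (p ^ n)) a x"
    using q by (simp add: f_def)
  finally show "(shift_diff u ^^ (p ^ n)) a x = ga_zero x" by (simp add: ga_zero_def)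
qed (simp_all add: shift_diff_pow_in a)

text \<open>The quotient by a central cyclic subgroup is realised on coset representatives, which keeps
  the element type and so allows induction over groups.\<close>

lemma ex_cyclic_quotient:
  assumes u: "u \<in> carrier G" "\<And>x. x \<in> carrier G \<Longrightarrow> u \<otimes> x = x \<otimes> u"
  obtains Q :: "'a monoid" and \<phi> where "fin_group_surj G Q \<phi>"
    "\<And>x y. x \<in> carrier G \<Longrightarrow> y \<in> carrier G \<Longrightarrow> \<phi> x = \<phi> y \<longleftrightarrow> (\<exists>i::nat. y = x \<otimes> u [^] i)"
proof -
  define R where "R x y \<longleftrightarrow> (\<exists>i::nat. y = x \<otimes> u [^] i)" for x y
  define \<phi> where "\<phi> x = (SOME y. y \<in> carrier G \<and> R x y)" for x
  have refl: "R x x" if "x \<in> carrier G" for x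
    unfolding R_def using that by (intro exI[of _ 0]) simp
  have sym: "R y x" if x: "x \<in> carrier G" and xy: "R x y" for x y
  proof -
    obtain i :: nat where i: "y = x \<otimes> u [^] i" using xy by (auto simp: R_def)
    \<comment> \<open>Exponents are natural numbers, so the inverse of u^i is written as u^((|G| -
      1) i).\<close>
    have "Coset.order G > 0" using fin by (simp add: order_gt_0_iff_finite)
    then have "i + (Coset.order G - 1) * i = Coset.order G * i" by (simp add: mult_eq_if)
    then have "u [^] i \<otimes> u [^] ((Coset.order G - 1) * i) = \<one>"
      using u(1) pow_order_eq_1[OF u(1)] nat_pow_pow[OF u(1), of "Coset.order G" i] by (simp add: nat_pow_mult)
    then have "x = y \<otimes> u [^] ((Coset.order G - 1) * i)" using i u(1) x by (simp add: m_assoc)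
    then show ?thesis by (auto simp: R_def)
  qed
  have trans: "R x z" if "x \<in> carrier G" "R x y" "R y z" for x y z
    using that u(1) by (auto simp: R_def m_assoc nat_pow_mult)
  have pow_comm: "u [^] i \<otimes> x = x \<otimes> u [^] i" if "x \<in> carrier G" for x and i :: nat
  proof (induction i)
    case (Suc i)
    have "u [^] Suc i \<otimes> x = u [^] i \<otimes> x \<otimes> u" using u that by (simp add: m_assoc)
    then show ?case using Suc u(1) that by (simp add: m_assoc)
  qed (use that in simp)
  have cong: "R (x \<otimes> y) (x' \<otimes> y')"
    if xy: "x \<in> carrier G" "y \<in> carrier G" and R: "R x x'" "R y y'" for x x' y y'
  proof -
    obtain i j :: nat where ij: "x' = x \<otimes> u [^] i" "y' = y \<otimes> u [^] j" using R by (auto simp: R_def)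
    have "x' \<otimes> y' = x \<otimes> (u [^] i \<otimes> y) \<otimes> u [^] j" using ij xy u(1) by (simp add: m_assoc)
    also have "\<dots> = x \<otimes> (y \<otimes> u [^] i) \<otimes> u [^] j" by (simp only: pow_comm[OF xy(2)])
    also have "\<dots> = x \<otimes> y \<otimes> u [^] (i + j)"
      using xy u(1) by (simp add: m_assoc nat_pow_mult)
    finally show ?thesis by (auto simp: R_def)
  qed
  have \<phi>: "\<phi> x \<in> carrier G" "R x (\<phi> x)" if "x \<in> carrier G" for x
    using someI[of "\<lambda>y. y \<in> carrier G \<and> R x y" x] that refl by (auto simp: \<phi>_def)
  have \<phi>_eq: "\<phi> x = \<phi> y \<longleftrightarrow> R x y" if xy: "x \<in> carrier G" "y \<in> carrier G" for x y
  proof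
    assume "\<phi> x = \<phi> y"
    then show "R x y" using \<phi> xy sym trans by metis
  next
    assume "R x y"
    \<comment> \<open>Equal predicates give equal choices, so \<open>\<phi>\<close> is constant on
      cosets.\<close>
    then have "R x = R y" using sym trans xy by (intro ext) metis
    then show "\<phi> x = \<phi> y" by (simp add: \<phi>_def)
  qed
  define Q where "Q = \<lparr>carrier = \<phi> ` carrier G, monoid.mult = (\<lambda>x y. \<phi> (x \<otimes> y)), one = \<phi> \<one>\<rparr>"
  have mult: "\<phi> (\<phi> x \<otimes> \<phi> y) = \<phi> (x \<otimes> y)" if "x \<in> carrier G" "y \<in> carrier G" for x y
  proof -
    have "R (\<phi> x \<otimes> \<phi> y) (x \<otimes> y)"
      by (rule sym[OF m_closed[OF that] cong[OF that \<phi>(2)[OF that(1)] \<phi>(2)[OF that(2)]]])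
    then show ?thesis using \<phi>_eq \<phi>(1) that by simp
  qed
  have "group Q"
  proof (rule groupI)
    fix a b c assume abc: "a \<in> carrier Q" "b \<in> carrier Q" "c \<in> carrier Q"
    then obtain x y z where x: "x \<in> carrier G" "y \<in> carrier G" "z \<in> carrier G"
      "a = \<phi> x" "b = \<phi> y" "c = \<phi> z" by (auto simp: Q_def)
    then show "a \<otimes>\<^bsub>Q\<^esub> b \<in> carrier Q" by (simp add: Q_def \<phi>)
    show "a \<otimes>\<^bsub>Q\<^esub> b \<otimes>\<^bsub>Q\<^esub> c = a \<otimes>\<^bsub>Q\<^esub> (b \<otimes>\<^bsub>Q\<^esub> c)"
      using x by (simp add: Q_def mult m_assoc)
    show "\<one>\<^bsub>Q\<^esub> \<otimes>\<^bsub>Q\<^esub> a = a" using x by (simp add: Q_def mult)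
    show "\<exists>y\<in>carrier Q. y \<otimes>\<^bsub>Q\<^esub> a = \<one>\<^bsub>Q\<^esub>"
      using x by (intro bexI[of _ "\<phi> (inv x)"]) (simp_all add: Q_def mult)
  qed (simp add: Q_def)
  then have "fin_group_surj G Q \<phi>"
    by (auto simp: fin_group_surj_def fin_group_surj_axioms_def fin_group_def fin_group_axioms_def
        hom_def is_group mult Q_def)
  then show thesis using that \<phi>_eq by (auto simp: R_def)
qed

end

section \<open>The quotient by a central cyclic p-subgroup\<close>

locale central_cyclic_quotient = fin_group_surj H Q \<phi>
  for H (structure) and Q (structure) and \<phi> +
  fixes u and p n :: nat
  assumes u: "u \<in> carrier H" "\<And>x. x \<in> carrier H \<Longrightarrow> u \<otimes>\<^bsub>H\<^esub> x = x \<otimes>\<^bsub>H\<^esub> u"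
    and ker: "\<And>x y. x \<in> carrier H \<Longrightarrow> y \<in> carrier H \<Longrightarrow>
        \<phi> x = \<phi> y \<longleftrightarrow> (\<exists>i::nat. y = x \<otimes>\<^bsub>H\<^esub> u [^]\<^bsub>H\<^esub> i)"
    and p: "prime p" and ord_u: "H.ord u = p ^ n"
begin

lemma u_pow: "u [^]\<^bsub>H\<^esub> (p ^ n) = \<one>\<^bsub>H\<^esub>"
  using H.pow_ord_eq_1[OF u(1)] ord_u by simp

text \<open>An element a that dies in FQ supplies one factor u - 1. In terms of annihilators: c, the
  k-th iterate applied to b, is invariant under u and so depends only on the coset; therefore a * c
  sees a only through its coset sums, which are 0.\<close>

lemma shift_diff_reduce:
  fixes a b :: "_ \<Rightarrow> 'f::field"
  assumes a: "push H Q \<phi> a = ga_zero"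
    and 0: "(H.shift_diff u ^^ Suc k) b = ga_zero"
  shows "(H.shift_diff u ^^ k) (ga_mult H a b) = ga_zero"
proof -
  define c where "c = (H.shift_diff u ^^ k) b"
  have step: "c (u \<otimes>\<^bsub>H\<^esub> x) = c x" if "x \<in> carrier H" for x
    using fun_cong[OF 0, of x] that by (simp add: c_def[symmetric] H.shift_diff_def ga_zero_def)
  have c: "c (u [^]\<^bsub>H\<^esub> i \<otimes>\<^bsub>H\<^esub> x) = c x" if "x \<in> carrier H" for x and i :: nat
    using that
  proof (induction i arbitrary: x)
    case (Suc i)
    have "u [^]\<^bsub>H\<^esub> Suc i \<otimes>\<^bsub>H\<^esub> x = u [^]\<^bsub>H\<^esub> i \<otimes>\<^bsub>H\<^esub> (u \<otimes>\<^bsub>H\<^esub> x)"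
      using u(1) Suc.prems by (simp add: H.m_assoc)
    then show ?case using Suc step u(1) by simp
  qed simp
  have fib: "c (inv\<^bsub>H\<^esub> y \<otimes>\<^bsub>H\<^esub> x) = c (inv\<^bsub>H\<^esub> y' \<otimes>\<^bsub>H\<^esub> x)"
    if y: "y \<in> carrier H" "y' \<in> carrier H" "\<phi> y = \<phi> y'" and x: "x \<in> carrier H" for x y y'
  proof -
    obtain i :: nat where i: "y' = y \<otimes>\<^bsub>H\<^esub> u [^]\<^bsub>H\<^esub> i" using ker[OF y(1,2)] y(3) by auto
    have "inv\<^bsub>H\<^esub> y = u [^]\<^bsub>H\<^esub> i \<otimes>\<^bsub>H\<^esub> inv\<^bsub>H\<^esub> y'"
      using y u(1) unfolding i by (simp add: H.inv_mult_group H.m_assoc flip: H.m_assoc[of "u [^]\<^bsub>H\<^esub> i"])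
    then show ?thesis using c[of "inv\<^bsub>H\<^esub> y' \<otimes>\<^bsub>H\<^esub> x" i] y x u(1) by (simp add: H.m_assoc)
  qed
  have "ga_mult H a c = ga_zero"
  proof (rule H.grp_alg_eqI)
    fix x assume x: "x \<in> carrier H"
    have "ga_mult H a c x
        = (\<Sum>q\<in>carrier Q. \<Sum>y\<in>{y\<in>carrier H. \<phi> y = q}. a y * c (inv\<^bsub>H\<^esub> y \<otimes>\<^bsub>H\<^esub> x))"
      unfolding H.ga_mult_apply[OF x] by (rule sum_over_fibres[symmetric])
    also have "\<dots> = 0"
    proof (rule sum.neutral, rule ballI)
      fix q assume q: "q \<in> carrier Q"
      then obtain y' where y': "y' \<in> carrier H" "\<phi> y' = q" using surj by (metis imageE)
      have "(\<Sum>y\<in>{y\<in>carrier H. \<phi> y = q}. a y * c (inv\<^bsub>H\<^esub> y \<otimes>\<^bsub>H\<^esub> x))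
          = push H Q \<phi> a q * c (inv\<^bsub>H\<^esub> y' \<otimes>\<^bsub>H\<^esub> x)"
        unfolding push_apply[OF q] sum_distrib_right
      proof (rule sum.cong[OF refl])
        fix y assume "y \<in> {y\<in>carrier H. \<phi> y = q}"
        then have "c (inv\<^bsub>H\<^esub> y \<otimes>\<^bsub>H\<^esub> x) = c (inv\<^bsub>H\<^esub> y' \<otimes>\<^bsub>H\<^esub> x)"
          by (intro fib) (use y' x in auto)
        then show "a y * c (inv\<^bsub>H\<^esub> y \<otimes>\<^bsub>H\<^esub> x) = a y * c (inv\<^bsub>H\<^esub> y' \<otimes>\<^bsub>H\<^esub> x)" by simp
      qed
      then show "(\<Sum>y\<in>{y\<in>carrier H. \<phi> y = q}. a y * c (inv\<^bsub>H\<^esub> y \<otimes>\<^bsub>H\<^esub> x)) = 0"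
        by (simp add: a ga_zero_def)
    qed
    finally show "ga_mult H a c x = ga_zero x" by (simp add: ga_zero_def)
  qed simp_all
  then show ?thesis by (simp add: c_def H.shift_diff_pow_mult[OF u])
qed

lemma push_prod:
  "push H Q \<phi> (foldr (ga_mult H) zs e) = foldr (ga_mult Q) (map (push H Q \<phi>) zs) (push H Q \<phi> e)"
  by (induction zs) (simp_all add: push_mult)

text \<open>Each group of L factors vanishes in FQ and so lowers the power of u - 1 that kills the
  product by one, by \<open>shift_diff_reduce\<close>. The start is (u^-1 - 1)^(p^n) = 0.\<close>

lemma shift_diff_prod:
  fixes e :: "_ \<Rightarrow> 'f::field"
  assumes char: "CHAR('f) = p"
    and e: "class_fun H e" "ga_mult H e e = e"
    and L: "\<And>ws. set ws \<subseteq> set zs \<Longrightarrow> length ws = L \<Longrightarrow> push H Q \<phi> (foldr (ga_mult H) ws e) = ga_zero"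
    and zs: "\<forall>z\<in>set zs. class_fun H z" "length zs = k * L" and k: "k \<le> p ^ n"
  shows "(H.shift_diff u ^^ (p ^ n - k)) (foldr (ga_mult H) zs e) = ga_zero"
  using L zs k
proof (induction k arbitrary: zs)
  case 0
  then show ?case
    using H.shift_diff_pow_eq_0[OF p char u(1) u_pow H.class_fun_in[OF e(1)]] by simp
next
  case (Suc k)
  define xs ys where "xs = take L zs" and "ys = drop L zs"
  have zs: "zs = xs @ ys" and len: "length xs = L" "length ys = k * L"
    using Suc.prems by (simp_all add: xs_def ys_def)
  have "foldr (ga_mult H) zs e = ga_mult H (foldr (ga_mult H) xs e) (foldr (ga_mult H) ys e)"
    unfolding zs by (rule H.prod_append_idem) (use e Suc.prems(2) zs in auto)
  moreover have "push H Q \<phi> (foldr (ga_mult H) xs e) = ga_zero"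
    using Suc.prems(1) len zs by auto
  moreover have "(H.shift_diff u ^^ (p ^ n - k)) (foldr (ga_mult H) ys e) = ga_zero"
    by (rule Suc.IH) (use Suc.prems zs len in auto)
  moreover have "p ^ n - k = Suc (p ^ n - Suc k)" using Suc.prems(4) by simp
  ultimately show ?case
    using shift_diff_reduce by metis
qed

text \<open>With k = p^n - 1 groups a single application of \<open>shift_diff u\<close> already
  gives 0, which is invariance under u. The groups are taken from the end of the list; the surplus
  factors in front commute with \<open>shift_diff u\<close>.\<close>

lemma shift_invariant_prod:
  fixes e :: "_ \<Rightarrow> 'f::field"
  assumes char: "CHAR('f) = p"
    and e: "class_fun H e" "ga_mult H e e = e"
    and L: "\<And>ws. set ws \<subseteq> set zs \<Longrightarrow> length ws = L \<Longrightarrow> push H Q \<phi> (foldr (ga_mult H) ws e) = ga_zero"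
    and zs: "\<forall>z\<in>set zs. class_fun H z" "(p ^ n - 1) * L \<le> length zs"
    and x: "x \<in> carrier H"
  shows "foldr (ga_mult H) zs e (u \<otimes>\<^bsub>H\<^esub> x) = foldr (ga_mult H) zs e x"
proof -
  define l where "l = length zs - (p ^ n - 1) * L"
  define ys where "ys = drop l zs"
  have "p ^ n > 0" using p prime_gt_0_nat by simp
  then have 1: "p ^ n - (p ^ n - 1) = 1" by linarith
  have ys: "set ys \<subseteq> set zs" "length ys = (p ^ n - 1) * L"
    using zs by (simp_all add: ys_def l_def set_drop_subset)
  have "(H.shift_diff u ^^ (p ^ n - (p ^ n - 1))) (foldr (ga_mult H) ys e) = ga_zero"
    by (rule shift_diff_prod[OF char e]) (use L zs ys in auto)
  then have 0: "H.shift_diff u (foldr (ga_mult H) ys e) = ga_zero" unfolding 1 by simp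
  have "H.shift_diff u (foldr (ga_mult H) xs (foldr (ga_mult H) ys e)) = ga_zero" for xs
    by (induction xs) (simp_all add: 0 H.shift_diff_mult[OF u])
  then have "H.shift_diff u (foldr (ga_mult H) (take l zs @ ys) e) = ga_zero" by simp
  then have "H.shift_diff u (foldr (ga_mult H) zs e) x = 0" by (simp add: ys_def ga_zero_def)
  then show ?thesis using x by (simp add: H.shift_diff_def)
qed

lemma ord_mult_inj: "x \<in> carrier H \<Longrightarrow> inj_on (\<lambda>i. x \<otimes>\<^bsub>H\<^esub> u [^]\<^bsub>H\<^esub> i) {..<p ^ n}"
proof (rule inj_onI)
  fix i j assume x: "x \<in> carrier H" and ij: "i \<in> {..<p ^ n}" "j \<in> {..<p ^ n}"
    and eq: "x \<otimes>\<^bsub>H\<^esub> u [^]\<^bsub>H\<^esub> i = x \<otimes>\<^bsub>H\<^esub> u [^]\<^bsub>H\<^esub> j"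
  from eq have "u [^]\<^bsub>H\<^esub> i = u [^]\<^bsub>H\<^esub> j" using x u(1) by simp
  then show "i = j" using H.ord_inj[OF u(1)] ij ord_u by (auto simp: inj_on_def)
qed

lemma pow_mod: "u [^]\<^bsub>H\<^esub> (i::nat) = u [^]\<^bsub>H\<^esub> (i mod p ^ n)"
proof -
  have "u [^]\<^bsub>H\<^esub> i = u [^]\<^bsub>H\<^esub> (p ^ n * (i div p ^ n) + i mod p ^ n)" by simp
  also have "\<dots> = (u [^]\<^bsub>H\<^esub> (p ^ n)) [^]\<^bsub>H\<^esub> (i div p ^ n) \<otimes>\<^bsub>H\<^esub> u [^]\<^bsub>H\<^esub> (i mod p ^ n)"
    using u(1) by (simp only: H.nat_pow_pow H.nat_pow_mult)
  finally show ?thesis using u(1) by (simp add: u_pow)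
qed

lemma fibre_eq:
  assumes "y \<in> carrier H"
  shows "{x\<in>carrier H. \<phi> x = \<phi> y} = (\<lambda>i. y \<otimes>\<^bsub>H\<^esub> u [^]\<^bsub>H\<^esub> i) ` {..<p ^ n}"
proof (intro equalityI subsetI)
  fix x assume "x \<in> {x\<in>carrier H. \<phi> x = \<phi> y}"
  then obtain i :: nat where "x = y \<otimes>\<^bsub>H\<^esub> u [^]\<^bsub>H\<^esub> i" using ker[OF assms, of x] by auto
  then have "x = y \<otimes>\<^bsub>H\<^esub> u [^]\<^bsub>H\<^esub> (i mod p ^ n)" using pow_mod[of i] by simp
  moreover have "i mod p ^ n < p ^ n" using p prime_gt_0_nat by simp
  ultimately show "x \<in> (\<lambda>i. y \<otimes>\<^bsub>H\<^esub> u [^]\<^bsub>H\<^esub> i) ` {..<p ^ n}" by blast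
next
  fix x assume "x \<in> (\<lambda>i. y \<otimes>\<^bsub>H\<^esub> u [^]\<^bsub>H\<^esub> i) ` {..<p ^ n}"
  then obtain i :: nat where i: "x = y \<otimes>\<^bsub>H\<^esub> u [^]\<^bsub>H\<^esub> i" by auto
  then have "x \<in> carrier H" using assms u(1) by simp
  then show "x \<in> {x\<in>carrier H. \<phi> x = \<phi> y}" using ker[OF assms, of x] i by auto
qed

lemma card_fibre: "y \<in> carrier H \<Longrightarrow> card {x\<in>carrier H. \<phi> x = \<phi> y} = p ^ n"
  by (simp only: fibre_eq card_image[OF ord_mult_inj] card_lessThan)

text \<open>If conjugation moves an element within its coset then the coset sum of \<open>e\<close> is a sum over
  nontrivial orbits of a \<open>p\<close>-element, hence zero.\<close>

lemma ex_centralizer_quotient: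
  fixes e :: "_ \<Rightarrow> 'f::field"
  assumes char: "CHAR('f) = p" and e: "class_fun H e"
    and q: "q \<in> carrier Q" and ne: "push H Q \<phi> e q \<noteq> 0"
  obtains y where "y \<in> carrier H" "e y \<noteq> 0"
    "card (centralizer_of Q q) * p ^ n = card (centralizer_of H y)"
proof -
  let ?F = "{x\<in>carrier H. \<phi> x = q}"
  obtain y where y: "y \<in> carrier H" "\<phi> y = q" "e y \<noteq> 0"
    using sum.not_neutral_contains_not_neutral[OF ne[unfolded push_apply[OF q]]] by auto
  have comm: "g \<in> centralizer_of H y" if g: "g \<in> carrier H" "\<phi> g \<in> centralizer_of Q q" for g
  proof (rule ccontr)
    assume neg: "g \<notin> centralizer_of H y"
    let ?y = "inv\<^bsub>H\<^esub> g \<otimes>\<^bsub>H\<^esub> y \<otimes>\<^bsub>H\<^esub> g"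
    have "\<phi> ?y = inv\<^bsub>Q\<^esub> (\<phi> g) \<otimes>\<^bsub>Q\<^esub> (\<phi> y \<otimes>\<^bsub>Q\<^esub> \<phi> g)" using g y q by (simp add: Q.m_assoc)
    also have "\<phi> y \<otimes>\<^bsub>Q\<^esub> \<phi> g = \<phi> g \<otimes>\<^bsub>Q\<^esub> \<phi> y" using g y by (simp add: centralizer_of_def)
    finally have "\<phi> y = \<phi> ?y" using g y q by (simp flip: Q.m_assoc)
    then obtain i :: nat where i: "?y = y \<otimes>\<^bsub>H\<^esub> u [^]\<^bsub>H\<^esub> i" using ker[OF y(1), of ?y] g y by auto
    \<comment> \<open>\<open>v\<close> is the commutator y^-1 g^-1 y g. As u is central, conjugation
      by g acts on the whole coset of y as right multiplication by v, so the class function e is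
      invariant under it; and v is not 1, so nothing is fixed.\<close>
    define v where "v = u [^]\<^bsub>H\<^esub> i"
    have v: "v \<in> carrier H" using u(1) by (simp add: v_def)
    have iv: "?y = y \<otimes>\<^bsub>H\<^esub> v" using i by (simp add: v_def)
    have v1: "v \<noteq> \<one>\<^bsub>H\<^esub>"
    proof
      assume "v = \<one>\<^bsub>H\<^esub>"
      then have "?y = y" using iv y by simp
      then have "g \<otimes>\<^bsub>H\<^esub> ?y = g \<otimes>\<^bsub>H\<^esub> y" by simp
      then have "y \<otimes>\<^bsub>H\<^esub> g = g \<otimes>\<^bsub>H\<^esub> y" using g y by (simp flip: H.m_assoc)
      then show False using neg g by (simp add: centralizer_of_def)
    qed
    have pows: "u [^]\<^bsub>H\<^esub> (a::nat) \<otimes>\<^bsub>H\<^esub> u [^]\<^bsub>H\<^esub> (b::nat) = u [^]\<^bsub>H\<^esub> b \<otimes>\<^bsub>H\<^esub> u [^]\<^bsub>H\<^esub> a" for a b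
      using u(1) by (simp add: H.nat_pow_mult add.commute)
    have ucomm: "u [^]\<^bsub>H\<^esub> (j::nat) \<otimes>\<^bsub>H\<^esub> x = x \<otimes>\<^bsub>H\<^esub> u [^]\<^bsub>H\<^esub> j" if "x \<in> carrier H" for j x
    proof (induction j)
      case (Suc j)
      have "u [^]\<^bsub>H\<^esub> Suc j \<otimes>\<^bsub>H\<^esub> x = u [^]\<^bsub>H\<^esub> j \<otimes>\<^bsub>H\<^esub> x \<otimes>\<^bsub>H\<^esub> u" using u that by (simp add: H.m_assoc)
      then show ?case using Suc u(1) that by (simp add: H.m_assoc)
    qed (use that in simp)
    have einv: "e (x \<otimes>\<^bsub>H\<^esub> v) = e x" if x: "x \<in> ?F" for x
    proof -
      obtain j :: nat where j: "x = y \<otimes>\<^bsub>H\<^esub> u [^]\<^bsub>H\<^esub> j" using fibre_eq[OF y(1)] x y(2) by auto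
      have uj: "u [^]\<^bsub>H\<^esub> j \<in> carrier H" using u(1) by simp
      have "x \<otimes>\<^bsub>H\<^esub> v = y \<otimes>\<^bsub>H\<^esub> v \<otimes>\<^bsub>H\<^esub> u [^]\<^bsub>H\<^esub> j"
        unfolding j v_def using u(1) y(1) by (simp add: H.m_assoc pows[of i j])
      also have "\<dots> = inv\<^bsub>H\<^esub> g \<otimes>\<^bsub>H\<^esub> y \<otimes>\<^bsub>H\<^esub> (g \<otimes>\<^bsub>H\<^esub> u [^]\<^bsub>H\<^esub> j)"
        unfolding iv[symmetric] using g y uj by (simp add: H.m_assoc)
      also have "\<dots> = inv\<^bsub>H\<^esub> g \<otimes>\<^bsub>H\<^esub> x \<otimes>\<^bsub>H\<^esub> g"
        unfolding ucomm[OF g(1), symmetric] j using g y uj by (simp add: H.m_assoc)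
      finally show ?thesis using H.class_fun_conj(2)[OF e g(1), of x] x by simp
    qed
    have "sum e ?F = sum e {x \<in> ?F. x \<otimes>\<^bsub>H\<^esub> v = x}"
    proof (rule sum_prime_power_period[OF _ p char, where k = n])
      have it: "((\<lambda>x. x \<otimes>\<^bsub>H\<^esub> v) ^^ m) x = x \<otimes>\<^bsub>H\<^esub> v [^]\<^bsub>H\<^esub> m" if "x \<in> carrier H" for m x
        using that v by (induction m) (simp_all add: H.m_assoc)
      have "v [^]\<^bsub>H\<^esub> (p ^ n) = (u [^]\<^bsub>H\<^esub> (p ^ n)) [^]\<^bsub>H\<^esub> i"
        using u(1) unfolding v_def by (simp only: H.nat_pow_pow mult.commute)
      then have "v [^]\<^bsub>H\<^esub> (p ^ n) = \<one>\<^bsub>H\<^esub>" by (simp add: u_pow)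
      then show "((\<lambda>x. x \<otimes>\<^bsub>H\<^esub> v) ^^ (p ^ n)) x = x" if "x \<in> ?F" for x
        using it that by simp
      show "x \<otimes>\<^bsub>H\<^esub> v \<in> ?F" if x: "x \<in> ?F" for x
      proof -
        have "\<phi> x = \<phi> (x \<otimes>\<^bsub>H\<^esub> v)" using ker[of x "x \<otimes>\<^bsub>H\<^esub> v"] x v v_def by auto
        then show ?thesis using x v by simp
      qed
    qed (use einv in auto)
    also have "{x \<in> ?F. x \<otimes>\<^bsub>H\<^esub> v = x} = {}" using v v1 by auto
    finally show False using ne by (simp add: push_apply[OF q])
  qed
  \<comment> \<open>The full preimage of the centralizer of q consists of fibres with p^n elements
    each, which gives the order formula.\<close>
  have "centralizer_of H y = {g \<in> carrier H. \<phi> g \<in> centralizer_of Q q}"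
  proof (intro equalityI subsetI)
    fix g assume g: "g \<in> centralizer_of H y"
    then have gH: "g \<in> carrier H" and "g \<otimes>\<^bsub>H\<^esub> y = y \<otimes>\<^bsub>H\<^esub> g"
      by (simp_all add: centralizer_of_def)
    then have "\<phi> g \<otimes>\<^bsub>Q\<^esub> \<phi> y = \<phi> y \<otimes>\<^bsub>Q\<^esub> \<phi> g"
      using hom_mult[OF gH y(1)] hom_mult[OF y(1) gH] by simp
    then show "g \<in> {g \<in> carrier H. \<phi> g \<in> centralizer_of Q q}"
      using gH y by (simp add: centralizer_of_def)
  qed (use comm in auto)
  also have "card \<dots> = (\<Sum>r\<in>centralizer_of Q q. card {g \<in> carrier H. \<phi> g = r})"
  proof -
    have "{g \<in> carrier H. \<phi> g \<in> centralizer_of Q q} = (\<Union>r\<in>centralizer_of Q q. {g \<in> carrier H. \<phi> g = r})" by auto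
    moreover have "finite (centralizer_of Q q)" by (auto simp: centralizer_of_def)
    ultimately show ?thesis by (simp only:) (subst card_UN_disjoint, auto)
  qed
  also have "\<dots> = (\<Sum>r\<in>centralizer_of Q q. p ^ n)"
  proof (rule sum.cong[OF refl])
    fix r assume "r \<in> centralizer_of Q q"
    then have "r \<in> carrier Q" by (simp add: centralizer_of_def)
    then obtain g where g: "g \<in> carrier H" "\<phi> g = r" using surj by (metis imageE)
    show "card {g \<in> carrier H. \<phi> g = r} = p ^ n" using card_fibre[OF g(1)] unfolding g(2) .
  qed
  finally have "card (centralizer_of Q q) * p ^ n = card (centralizer_of H y)" by simp
  then show thesis using that y by blast
qed

end

section \<open>The annihilator of nilpotent central elements\<close>

context fin_group
begin

abbreviation ga_pow :: "('a \<Rightarrow> 'f::field) \<Rightarrow> nat \<Rightarrow> 'a \<Rightarrow> 'f" where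
  "ga_pow b n \<equiv> (ga_mult G b ^^ n) (single \<one>)"

definition tuples :: "nat \<Rightarrow> 'a list set" where
  "tuples n = {xs. set xs \<subseteq> carrier G \<and> length xs = n}"

abbreviation tuple_prod :: "'a list \<Rightarrow> 'a" where
  "tuple_prod xs \<equiv> foldr (\<otimes>) xs \<one>"

lemma finite_tuples: "finite (tuples n)"
  unfolding tuples_def by (rule finite_lists_length_eq[OF fin])

lemma tuple_prod_closed: "set xs \<subseteq> carrier G \<Longrightarrow> tuple_prod xs \<in> carrier G"
  by (induction xs) auto

lemma tuple_prod_append:
  "set xs \<subseteq> carrier G \<Longrightarrow> y \<in> carrier G \<Longrightarrow> tuple_prod (xs @ [y]) = tuple_prod xs \<otimes> y"
  by (induction xs) (auto simp: m_assoc tuple_prod_closed)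

lemma tuple_prod_replicate: "g \<in> carrier G \<Longrightarrow> tuple_prod (replicate n g) = g [^] n"
proof (induction n)
  case (Suc n)
  then show ?case using nat_pow_Suc2[OF Suc.prems, of n] by simp
qed simp

text \<open>Extend \<open>\<theta>\<close> linearly to FG and evaluate it at b^n: multiplying out
  produces one summand per tuple, a set on which rotation can act.\<close>

lemma sum_ga_pow:
  "(\<Sum>g\<in>carrier G. \<theta> g * ga_pow b n g) = (\<Sum>xs\<in>tuples n. prod_list (map b xs) * \<theta> (tuple_prod xs))"
proof (induction n arbitrary: \<theta>)
  case 0
  have "tuples 0 = {[]}" by (auto simp: tuples_def)
  moreover have "(\<Sum>g\<in>carrier G. \<theta> g * single \<one> g) = (\<Sum>g\<in>carrier G. if g = \<one> then \<theta> g else 0)"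
    by (rule sum.cong) (auto simp: single_def)
  ultimately show ?case by (simp add: sum.delta)
next
  case (Suc n)
  have "(\<Sum>g\<in>carrier G. \<theta> g * ga_pow b (Suc n) g)
      = (\<Sum>g\<in>carrier G. \<Sum>y\<in>carrier G. b y * (\<theta> g * ga_pow b n (inv y \<otimes> g)))"
    by (rule sum.cong[OF refl]) (simp add: ga_mult_apply sum_distrib_left mult.left_commute)
  also have "\<dots> = (\<Sum>y\<in>carrier G. b y * (\<Sum>g\<in>carrier G. \<theta> g * ga_pow b n (inv y \<otimes> g)))"
    by (subst sum.swap) (simp add: sum_distrib_left)
  also have "\<dots> = (\<Sum>y\<in>carrier G. \<Sum>xs\<in>tuples n. prod_list (map b (y # xs)) * \<theta> (tuple_prod (y # xs)))"
  proof (rule sum.cong[OF refl])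
    fix y assume y: "y \<in> carrier G"
    have "(\<Sum>g\<in>carrier G. \<theta> g * ga_pow b n (inv y \<otimes> g))
        = (\<Sum>g\<in>carrier G. \<theta> (y \<otimes> g) * ga_pow b n (inv y \<otimes> (y \<otimes> g)))"
      by (rule sum_translate_left[OF y, symmetric])
    also have "\<dots> = (\<Sum>g\<in>carrier G. \<theta> (y \<otimes> g) * ga_pow b n g)"
      by (rule sum.cong[OF refl]) (simp add: y flip: m_assoc)
    finally show "b y * (\<Sum>g\<in>carrier G. \<theta> g * ga_pow b n (inv y \<otimes> g))
        = (\<Sum>xs\<in>tuples n. prod_list (map b (y # xs)) * \<theta> (tuple_prod (y # xs)))"
      using Suc.IH[of "\<lambda>g. \<theta> (y \<otimes> g)"] by (simp add: sum_distrib_left mult.assoc)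
  qed
  also have "\<dots> = (\<Sum>(y, xs)\<in>carrier G \<times> tuples n. prod_list (map b (y # xs)) * \<theta> (tuple_prod (y # xs)))"
    by (rule sum.cartesian_product)
  also have "\<dots> = (\<Sum>xs\<in>tuples (Suc n). prod_list (map b xs) * \<theta> (tuple_prod xs))"
    by (rule sum.reindex_bij_witness[of _ "\<lambda>xs. (hd xs, tl xs)" "\<lambda>(y, xs). y # xs"])
      (auto simp: tuples_def length_Suc_conv)
  finally show ?case .
qed

text \<open>Cyclic rotation acts on the tuples of length \<open>p ^ k\<close>, and only constant tuples are fixed.\<close>

lemma sum_ga_pow_prime_power:
  fixes b \<theta> :: "'a \<Rightarrow> 'f::field"
  assumes p: "prime p" "CHAR('f) = p"
    and \<theta>: "\<And>x y. x \<in> carrier G \<Longrightarrow> y \<in> carrier G \<Longrightarrow> \<theta> (x \<otimes> y) = \<theta> (y \<otimes> x)"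
  shows "(\<Sum>g\<in>carrier G. \<theta> g * ga_pow b (p ^ k) g) = (\<Sum>g\<in>carrier G. b g ^ (p ^ k) * \<theta> (g [^] (p ^ k)))"
proof -
  define f where "f xs = prod_list (map b xs) * \<theta> (tuple_prod xs)" for xs
  have q: "p ^ k > 0" using p(1) prime_gt_0_nat by simp
  have "(\<Sum>g\<in>carrier G. \<theta> g * ga_pow b (p ^ k) g) = sum f (tuples (p ^ k))"
    by (simp add: sum_ga_pow f_def)
  also have "\<dots> = sum f {xs \<in> tuples (p ^ k). rotate1 xs = xs}"
  proof (rule sum_prime_power_period[OF finite_tuples p, where k = k])
    show "rotate1 xs \<in> tuples (p ^ k)" if "xs \<in> tuples (p ^ k)" for xs
      using that by (simp add: tuples_def)
    show "(rotate1 ^^ (p ^ k)) xs = xs" if "xs \<in> tuples (p ^ k)" for xs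
      using that rotate_id[of "p ^ k" xs] by (simp add: tuples_def rotate_def)
    \<comment> \<open>Rotation turns a product y * r into r * y, which \<open>\<theta>\<close> does
      not distinguish.\<close>
    show "f (rotate1 xs) = f xs" if "xs \<in> tuples (p ^ k)" for xs
    proof (cases xs)
      case (Cons y ys)
      then have "y \<in> carrier G" "set ys \<subseteq> carrier G" using that by (auto simp: tuples_def)
      then show ?thesis
        using Cons \<theta>[of y "tuple_prod ys"]
        by (simp add: f_def tuple_prod_append tuple_prod_closed mult.commute del: foldr_append)
    qed simp
  qed
  also have "{xs \<in> tuples (p ^ k). rotate1 xs = xs} = replicate (p ^ k) ` carrier G"
  proof (intro equalityI subsetI)
    fix xs assume xs: "xs \<in> {xs \<in> tuples (p ^ k). rotate1 xs = xs}"
    then have "xs \<noteq> []" using q by (auto simp: tuples_def)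
    then have "card (set xs) = 1" using rotate1_fixpoint_card[of xs] xs by simp
    then obtain g where g: "set xs = {g}" by (auto simp: card_1_singleton_iff)
    then have "xs = replicate (p ^ k) g"
      using xs by (intro replicate_eqI) (auto simp: tuples_def)
    then show "xs \<in> replicate (p ^ k) ` carrier G" using g xs by (auto simp: tuples_def)
  next
    fix xs assume "xs \<in> replicate (p ^ k) ` carrier G"
    then show "xs \<in> {xs \<in> tuples (p ^ k). rotate1 xs = xs}" by (auto simp: tuples_def rotate1_replicate)
  qed
  also have "sum f (replicate (p ^ k) ` carrier G) = (\<Sum>g\<in>carrier G. f (replicate (p ^ k) g))"
    using q by (intro sum.reindex_cong[OF _ refl refl]) (auto simp: inj_on_def)
  also have "\<dots> = (\<Sum>g\<in>carrier G. b g ^ (p ^ k) * \<theta> (g [^] (p ^ k)))"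
    by (rule sum.cong[OF refl]) (simp add: f_def tuple_prod_replicate prod_list_replicate del: foldr_replicate)
  finally show ?thesis .
qed

text \<open>The hypothesis says z^(n+1) = 0, whence the strict inequality n < k.\<close>

lemma nilpotent_funpow_eq_0:
  assumes "(ga_mult G z ^^ n) z = ga_zero" "n < k"
  shows "(ga_mult G z ^^ k) y = ga_zero"
proof -
  obtain j where k: "k = j + Suc n" using assms(2) by (metis less_iff_Suc_add add.commute add_Suc_right)
  have "(ga_mult G z ^^ Suc n) y = (ga_mult G z ^^ n) z \<star> y"
    by (simp add: funpow_swap1 pow_mult_right del: funpow.simps add: funpow_Suc_right)
  then have "(ga_mult G z ^^ Suc n) y = ga_zero" using assms(1) by simp
  moreover have "(ga_mult G z ^^ j) ga_zero = ga_zero" by (induction j) simp_all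
  ultimately show ?thesis unfolding k funpow_add comp_apply by simp
qed

lemma ga_pow_mult_central:
  assumes "class_fun G z"
  shows "(ga_mult G (z \<star> s) ^^ k) y = (ga_mult G z ^^ k) ((ga_mult G s ^^ k) y)"
proof (induction k)
  case (Suc k)
  then show ?case
    by (simp add: ga_mult_assoc flip: pow_commute[OF assms])
qed simp

text \<open>Let q be a large power of p for which g^q is the p'-part of g. By \<open>inv\<close>,
  w(g) = w(g^q), so w is constant on the elements with conjugate p'-parts. The coefficient of z * w
  at x pairs w with b = z * x^-1, so it suffices that the sum of b over each such set is 0. The q-th
  power of that sum is a class function evaluated at b^q, and b^q = z^q x^-q = 0.\<close>

lemma nilpotent_mult_eq_0:
  fixes z w :: "'a \<Rightarrow> 'f::field"
  assumes p: "prime p" "CHAR('f) = p"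
    and z: "class_fun G z" "ga_nilpotent G z" and w: "class_fun G w"
    and inv: "\<And>u k x. u \<in> carrier G \<Longrightarrow> u [^] (p ^ k) = \<one> \<Longrightarrow> x \<in> centralizer_of G u \<Longrightarrow> w (u \<otimes> x) = w x"
  shows "z \<star> w = ga_zero"
proof -
  obtain N where N: "(ga_mult G z ^^ N) z = ga_zero" using z(2) by (auto simp: ga_nilpotent_def)
  define M where "M = card (carrier G)"
  have M0: "M > 0" unfolding M_def using fin one_closed card_gt_0_iff by blast
  have pow_M: "g [^] M = \<one>" if "g \<in> carrier G" for g
    using pow_order_eq_1[OF that] by (simp add: M_def Coset.order_def)
  obtain a m where m: "M = p ^ a * m" "\<not> p dvd m"
    using multiplicity_decompose'[of M p] M0 p(1) by (metis mult.commute not_prime_unit not_gr_zero)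
  have m0: "m > 0" using m M0 by (cases m) auto
  \<comment> \<open>The multiple of \<open>totient m\<close> gives q = 1 modulo m by Euler's
    theorem. The other factor makes k > a + N, hence q > N, so that z^q = 0.\<close>
  define k where "k = totient m * (a + N + 1)"
  define q where "q = p ^ k"
  have tot: "totient m > 0" using m0 by simp
  have kN: "a + N < k" unfolding k_def using tot by (cases "totient m") auto
  have "k < q" unfolding q_def using p(1) by (simp add: less_exp prime_ge_2_nat power_gt_expt prime_gt_Suc_0_nat)
  then have qN: "N < q" using kN by simp
  have "coprime p m" using m(2) p(1) prime_imp_coprime by blast
  then have "[p ^ totient m = 1] (mod m)" by (rule euler_theorem)
  then have "[(p ^ totient m) ^ (a + N + 1) = 1 ^ (a + N + 1)] (mod m)" by (rule cong_pow)
  then have q1: "[q = 1] (mod m)" unfolding q_def k_def power_mult by (simp only: power_one)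
  have "q \<ge> 1" using \<open>k < q\<close> by simp
  then obtain t where t: "q = 1 + m * t"
    using q1 by (metis cong_iff_lin_nat cong_sym le_Suc_ex cong_to_1_nat dvd_def le_add_diff_inverse)
  have w_pow: "w g = w (g [^] q)" if g: "g \<in> carrier G" for g
  proof -
    \<comment> \<open>Modulo M this exponent is 1 - q, written with natural numbers:
      \<open>g [^] r\<close> is the p-part of g and \<open>g [^] q\<close> its p'-part.\<close>
    define r where "r = 1 + q * (M - 1)"
    have M1: "M = Suc (M - 1)" using M0 by simp
    have "r + q = 1 + M * q" unfolding r_def by (subst (2) M1) simp
    then have "g [^] r \<otimes> g [^] q = g [^] (1 + M * q)" using g by (simp only: nat_pow_mult)
    also have "\<dots> = g [^] (1::nat) \<otimes> (g [^] M) [^] q"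
      using nat_pow_mult[OF g, of 1 "M * q"] g by (simp only: nat_pow_pow)
    finally have gr: "g [^] r \<otimes> g [^] q = g" using pow_M g by simp
    have "r = M + m * t * (M - 1)" unfolding r_def t by (subst (2) M1) (simp add: algebra_simps)
    then have "p ^ a * r = M * (p ^ a + t * (M - 1))" using m(1) by (simp add: algebra_simps)
    then have "(g [^] r) [^] (p ^ a) = (g [^] M) [^] (p ^ a + t * (M - 1))"
      using g by (simp add: nat_pow_pow mult.commute)
    then have "(g [^] r) [^] (p ^ a) = \<one>" using pow_M g by simp
    moreover have "g [^] q \<in> centralizer_of G (g [^] r)"
      using g by (simp add: centralizer_of_def nat_pow_mult add.commute)
    ultimately show ?thesis using inv[of "g [^] r" a "g [^] q"] g gr by simp
  qed
  define cl where "cl g = {h \<otimes> g \<otimes> inv h | h. h \<in> carrier G}" for g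
  have cl_self: "g \<in> cl g" if "g \<in> carrier G" for g
    unfolding cl_def using that by (intro CollectI exI[of _ \<one>]) simp
  have cl_sub: "cl (x \<otimes> y) \<subseteq> cl (y \<otimes> x)" if xy: "x \<in> carrier G" "y \<in> carrier G" for x y
  proof
    fix g assume "g \<in> cl (x \<otimes> y)"
    then obtain h where h: "h \<in> carrier G" "g = h \<otimes> (x \<otimes> y) \<otimes> inv h" by (auto simp: cl_def)
    have "g = (h \<otimes> x) \<otimes> (y \<otimes> x) \<otimes> inv (h \<otimes> x)"
      using h xy by (simp add: inv_mult_group m_assoc) (simp flip: m_assoc)
    then show "g \<in> cl (y \<otimes> x)" using h xy by (auto simp: cl_def)
  qed
  have "(z \<star> w) x = 0" if x: "x \<in> carrier G" for x
  proof -
    define b where "b = z \<star> single (inv x)"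
    have b: "b g = z (g \<otimes> x)" if "g \<in> carrier G" for g
      using that x by (simp add: b_def mult_single)
    have b0: "ga_pow b q = ga_zero"
      unfolding b_def ga_pow_mult_central[OF z(1)] by (rule nilpotent_funpow_eq_0[OF N qN])
    \<comment> \<open>Raising to the power q is additive and, over a field, reflects 0; so it is
      enough to sum the q-th powers, which \<open>sum_ga_pow_prime_power\<close> reads off from
      b^q.\<close>
    have zero: "(\<Sum>y\<in>{y\<in>carrier G. cl (y [^] q) = K}. b y) = 0" for K
    proof -
      define \<theta> where "\<theta> g = (if cl g = K then 1 else 0 :: 'f)" for g
      have "0 = (\<Sum>g\<in>carrier G. b g ^ q * \<theta> (g [^] q))"
        unfolding q_def
      proof (subst sum_ga_pow_prime_power[OF p, symmetric])
        show "\<theta> (x \<otimes> y) = \<theta> (y \<otimes> x)" if "x \<in> carrier G" "y \<in> carrier G" for x y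
          using cl_sub[OF that] cl_sub[OF that(2,1)] by (simp add: \<theta>_def)
        show "0 = (\<Sum>g\<in>carrier G. \<theta> g * ga_pow b (p ^ k) g)"
          using b0 by (simp add: q_def ga_zero_def)
      qed
      also have "\<dots> = (\<Sum>y\<in>{y\<in>carrier G. cl (y [^] q) = K}. b y ^ q)"
        by (intro sum.mono_neutral_cong_right) (auto simp: \<theta>_def)
      also have "\<dots> = (\<Sum>y\<in>{y\<in>carrier G. cl (y [^] q) = K}. b y) ^ q"
        using freshmans_dream_sum'[of "q" k b "{y\<in>carrier G. cl (y [^] q) = K}"] p by (simp add: q_def)
      finally show ?thesis by simp
    qed
    have "(z \<star> w) x = (w \<star> z) x" by (simp add: class_fun_commute[OF w])
    also have "\<dots> = (\<Sum>y\<in>carrier G. w y * b (inv y))"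
      unfolding ga_mult_apply[OF x] by (rule sum.cong) (simp_all add: b)
    also have "\<dots> = (\<Sum>y\<in>carrier G. w (inv y) * b y)"
      using sum_inv[of "\<lambda>y. w y * b (inv y)"] by simp
    also have "\<dots> = (\<Sum>K\<in>(\<lambda>y. cl (y [^] q)) ` carrier G.
        \<Sum>y\<in>{y\<in>carrier G. cl (y [^] q) = K}. w (inv y) * b y)"
      by (rule sum.group[OF fin finite_imageI[OF fin] order_refl, symmetric])
    also have "\<dots> = 0"
    proof (rule sum.neutral, rule ballI, erule imageE)
      fix K v assume K: "K = cl (v [^] q)" and v: "v \<in> carrier G"
      have "w (inv y) = w (inv v)" if y: "y \<in> carrier G" "cl (y [^] q) = K" for y
      proof -
        have "y [^] q \<in> cl (v [^] q)" using cl_self[of "y [^] q"] y K by simp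
        then obtain h where h: "h \<in> carrier G" "y [^] q = h \<otimes> v [^] q \<otimes> inv h" by (auto simp: cl_def)
        have "w (inv y) = w (inv (y [^] q))"
          using w_pow[of "inv y"] y by (simp add: nat_pow_inv)
        also have "inv (y [^] q) = h \<otimes> inv (v [^] q) \<otimes> inv h"
          unfolding h(2) using h(1) v by (simp add: inv_mult_group m_assoc)
        also have "w \<dots> = w (inv (v [^] q))" using class_fun_conj(1)[OF w h(1)] v by simp
        also have "\<dots> = w (inv v)" using w_pow[of "inv v"] v by (simp add: nat_pow_inv)
        finally show ?thesis .
      qed
      then have "(\<Sum>y\<in>{y\<in>carrier G. cl (y [^] q) = K}. w (inv y) * b y)
          = (\<Sum>y\<in>{y\<in>carrier G. cl (y [^] q) = K}. w (inv v) * b y)"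
        by (intro sum.cong) auto
      then show "(\<Sum>y\<in>{y\<in>carrier G. cl (y [^] q) = K}. w (inv y) * b y) = 0"
        by (simp add: zero flip: sum_distrib_left)
    qed
    finally show ?thesis .
  qed
  then show ?thesis by (intro grp_alg_eqI ga_mult_closed ga_zero_in) (simp add: ga_zero_def)
qed

end

section \<open>Products of nilpotent central elements\<close>

text \<open>A form of "defect at most d" that makes sense for any coefficient function. It passes to
  centralizers by Lagrange, and modulo a central element of order p^n it improves from d to d - n,
  by \<open>ex_centralizer_quotient\<close>.\<close>

definition small_defect :: "('g,'b) monoid_scheme \<Rightarrow> nat \<Rightarrow> nat \<Rightarrow> ('g \<Rightarrow> 'f::field) \<Rightarrow> bool" where
  "small_defect G p d e \<longleftrightarrow> (\<forall>x\<in>carrier G. e x \<noteq> 0 \<longrightarrow> \<not> p ^ Suc d dvd card (centralizer_of G x))"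

lemma (in fin_group_surj) push_nilpotent:
  assumes "ga_nilpotent H z" shows "ga_nilpotent Q (push H Q \<phi> z)"
proof -
  have "push H Q \<phi> ((ga_mult H z ^^ n) z) = (ga_mult Q (push H Q \<phi> z) ^^ n) (push H Q \<phi> z)" for n
    by (induction n) (simp_all add: push_mult)
  moreover have "push H Q \<phi> ga_zero = ga_zero" by (simp add: push_def ga_zero_def fun_eq_iff)
  ultimately show ?thesis using assms unfolding ga_nilpotent_def by metis
qed

context fin_group
begin

lemma card_centralizer_restr_dvd:
  assumes C: "subgroup C G" and y: "y \<in> C"
  shows "card (centralizer_of (restr_grp G C) y) dvd card (centralizer_of G y)"
proof -
  have yG: "y \<in> carrier G" using subgroup.mem_carrier[OF C y] .
  have S: "subgroup (centralizer_of G y) G" by (rule subgroup_centralizer_of[OF yG])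
  have eq: "centralizer_of (restr_grp G C) y = C \<inter> centralizer_of G y"
    using subgroup.subset[OF C] by (auto simp: centralizer_of_def)
  have "subgroup (C \<inter> centralizer_of G y) G" by (rule subgroups_Inter_pair[OF C S])
  then have "subgroup (C \<inter> centralizer_of G y) (restr_grp G (centralizer_of G y))"
    by (rule subgroup_incl[OF _ S]) simp
  from group.lagrange[OF subgroup_imp_group[OF S] this]
  have "card (centralizer_of G y) = card (rcosets\<^bsub>restr_grp G (centralizer_of G y)\<^esub> (C \<inter> centralizer_of G y))
      * card (C \<inter> centralizer_of G y)"
    by (simp add: Coset.order_def)
  then show ?thesis unfolding eq by (rule dvdI[OF trans[OF _ mult.commute]])
qed

lemma restr_prod:
  fixes e :: "'a \<Rightarrow> 'f::field"
  assumes p: "prime p" "CHAR('f) = p"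
    and u: "u \<in> carrier G" "u [^] (p ^ k) = \<one>"
    and e: "class_fun G e" and zs: "\<forall>z\<in>set zs. class_fun G z"
  defines "C \<equiv> centralizer_of G u"
  shows "restr C (foldr (\<star>) zs e) = foldr (ga_mult (restr_grp G C)) (map (restr C) zs) (restr C e)"
  using zs
proof (induction zs)
  case (Cons z zs)
  then show ?case
    using restr_centralizer_mult[OF p u, of z "foldr (\<star>) zs e"] class_fun_prod[of zs e] e
    by (simp add: C_def)
qed simp

lemma restr_nilpotent:
  fixes z :: "'a \<Rightarrow> 'f::field"
  assumes p: "prime p" "CHAR('f) = p"
    and u: "u \<in> carrier G" "u [^] (p ^ k) = \<one>"
    and z: "class_fun G z" "ga_nilpotent G z"
  defines "C \<equiv> centralizer_of G u"
  shows "ga_nilpotent (restr_grp G C) (restr C z)"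
proof -
  have cf: "class_fun G ((ga_mult G z ^^ n) z)" for n
    by (induction n) (simp_all add: z class_fun_mult)
  have "restr C ((ga_mult G z ^^ n) z) = (ga_mult (restr_grp G C) (restr C z) ^^ n) (restr C z)" for n
  proof (induction n)
    case (Suc n)
    then show ?case using restr_centralizer_mult[OF p u z(1) cf[of n]] by (simp add: C_def)
  qed simp
  moreover have "restr C ga_zero = ga_zero" by (simp add: restr_def ga_zero_def fun_eq_iff)
  ultimately show ?thesis using z(2) unfolding ga_nilpotent_def by metis
qed

text \<open>The vanishing for smaller defect is a hypothesis, \<open>IH\<close>, so that the same
  argument serves twice: inside the induction with \<open>\<epsilon> = d\<close>, and for the block
  itself with the exponent of D.\<close>

lemma prod_shift_invariant:
  fixes e :: "'a \<Rightarrow> 'f::field"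
  assumes p: "prime p" "CHAR('f) = p"
    and e: "class_fun G e" "e \<star> e = e" "small_defect G p d e"
    and eps: "\<And>x u k. x \<in> carrier G \<Longrightarrow> e x \<noteq> 0 \<Longrightarrow> u \<in> centralizer_of G x \<Longrightarrow>
        u [^] (p ^ k) = \<one> \<Longrightarrow> u [^] (p ^ \<epsilon>) = \<one>"
    and IH: "\<And>n (Q::'a monoid) (e'::'a \<Rightarrow> 'f) ws. 0 < n \<Longrightarrow> n \<le> d \<Longrightarrow> fin_group Q \<Longrightarrow>
        class_fun Q e' \<Longrightarrow> ga_mult Q e' e' = e' \<Longrightarrow> small_defect Q p (d - n) e' \<Longrightarrow>
        \<forall>z\<in>set ws. class_fun Q z \<and> ga_nilpotent Q z \<Longrightarrow> length ws = p ^ (d - n) \<Longrightarrow>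
        foldr (ga_mult Q) ws e' = ga_zero"
    and zs: "\<forall>z\<in>set zs. class_fun G z \<and> ga_nilpotent G z" "p ^ d - p ^ (d - \<epsilon>) \<le> length zs"
    and u: "u \<in> carrier G" "u [^] (p ^ k) = \<one>" and x: "x \<in> centralizer_of G u"
  shows "foldr (\<star>) zs e (u \<otimes> x) = foldr (\<star>) zs e x"
proof -
  note char = p(2)
  define C where "C = centralizer_of G u"
  let ?H = "restr_grp G C"
  have C: "subgroup C G" unfolding C_def by (rule subgroup_centralizer_of[OF u(1)])
  interpret H: fin_group ?H by (rule fin_group_restr[OF C])
  define e' where "e' = restr C e"
  define zs' where "zs' = map (restr C) zs"
  have uC: "u \<in> C" using u(1) by (simp add: C_def centralizer_of_def)
  have xC: "x \<in> C" using x by (simp add: C_def)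
  have e': "class_fun ?H e'" "ga_mult ?H e' e' = e'"
    using class_fun_restr[OF C e(1)] restr_centralizer_mult[OF p u e(1) e(1)] e(2)
    by (simp_all add: e'_def C_def)
  have zs': "class_fun ?H z \<and> ga_nilpotent ?H z" if "z \<in> set zs'" for z
    using that zs(1) class_fun_restr[OF C] restr_nilpotent[OF p u] by (auto simp: zs'_def C_def)
  have prod: "restr C (foldr (\<star>) zs e) = foldr (ga_mult ?H) zs' e'"
    using restr_prod[OF p u e(1), of zs] zs(1) by (simp add: e'_def zs'_def C_def)
  have val: "foldr (\<star>) zs e y = foldr (ga_mult ?H) zs' e' y" if "y \<in> C" for y
    using that by (simp flip: prod add: restr_def)
  have "foldr (ga_mult ?H) zs' e' (u \<otimes> x) = foldr (ga_mult ?H) zs' e' x"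
  \<comment> \<open>If the Brauer homomorphism kills e, there is no point of the support in C to
    bound the order of u, but the product is then 0.\<close>
  proof (cases "e' = ga_zero")
    case True
    have "foldr (ga_mult ?H) ws e' = e'" for ws by (induction ws) (simp_all add: True)
    then show ?thesis by (simp add: True) (simp add: ga_zero_def)
  next
    case False
    \<comment> \<open>A support point in C bounds the order p^n of u twice: \<open>eps\<close> gives
      n \<le> \<epsilon>, and \<open>small_defect\<close> gives n \<le> d because p^n divides the
      order of the centralizer of x0.\<close>
    then obtain x0 where "e' x0 \<noteq> 0" by (auto simp: ga_zero_def fun_eq_iff)
    then have x0: "x0 \<in> C" "e x0 \<noteq> 0" by (auto simp: e'_def restr_def split: if_splits)
    then have x0G: "x0 \<in> carrier G" and ux0: "u \<in> centralizer_of G x0"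
      using u(1) by (auto simp: C_def centralizer_of_def)
    have pow_H: "u [^]\<^bsub>?H\<^esub> (i::nat) = u [^] i" for i by (simp flip: nat_pow_consistent)
    have "H.ord u dvd p ^ k" using H.pow_eq_id[of u "p ^ k"] uC u(2) pow_H by simp
    then obtain n where n: "H.ord u = p ^ n" using divides_primepow_nat[OF p(1)] by auto
    have p2: "p \<ge> 2" using p(1) prime_ge_2_nat by blast
    have ord_dvd: "p ^ n dvd i" if "u [^] i = \<one>" for i
      using that H.pow_eq_id[of u i] uC pow_H n by simp
    have "n \<le> \<epsilon>" using ord_dvd[OF eps[OF x0G x0(2) ux0 u(2)]] p2 by (simp add: dvd_power_iff_le)
    have "n \<le> d"
    proof (rule ccontr)
      assume "\<not> n \<le> d"
      then have "p ^ Suc d dvd p ^ n" using p2 by (simp only: dvd_power_iff_le Suc_le_eq not_le)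
      moreover have "p ^ n dvd card (centralizer_of G x0)"
      proof (rule ord_dvd)
        interpret K: fin_group "restr_grp G (centralizer_of G x0)"
          by (rule fin_group_restr[OF subgroup_centralizer_of[OF x0G]])
        show "u [^] card (centralizer_of G x0) = \<one>"
          using K.pow_order_eq_1[of u] ux0 by (simp add: Coset.order_def flip: nat_pow_consistent)
      qed
      ultimately have "p ^ Suc d dvd card (centralizer_of G x0)" by (rule dvd_trans)
      then show False using e(3) x0G x0(2) by (simp add: small_defect_def)
    qed
    show ?thesis
    proof (cases "n = 0")
      case True
      then have "u = \<one>" using ord_dvd n H.ord_eq_1[of u] uC by simp
      then show ?thesis using subgroup.mem_carrier[OF C xC] by simp
    next
      case False
      have ucent: "u \<otimes>\<^bsub>?H\<^esub> y = y \<otimes>\<^bsub>?H\<^esub> u" if "y \<in> carrier ?H" for y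
        using that by (simp add: C_def centralizer_of_def)
      obtain Q :: "'a monoid" and \<phi> where Q: "fin_group_surj ?H Q \<phi>"
        and ker: "\<And>x y. x \<in> carrier ?H \<Longrightarrow> y \<in> carrier ?H \<Longrightarrow>
          \<phi> x = \<phi> y \<longleftrightarrow> (\<exists>i::nat. y = x \<otimes>\<^bsub>?H\<^esub> u [^]\<^bsub>?H\<^esub> i)"
        using H.ex_cyclic_quotient[of u] uC ucent by auto
      interpret fin_group_surj ?H Q \<phi> by (rule Q)
      interpret central_cyclic_quotient ?H Q \<phi> u p n
        by unfold_locales (use uC ucent ker p(1) n in auto)
      have sd: "small_defect Q p (d - n) (push ?H Q \<phi> e')"
        unfolding small_defect_def
      proof (intro ballI impI notI)
        fix q assume q: "q \<in> carrier Q" "push ?H Q \<phi> e' q \<noteq> 0"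
          and dv: "p ^ Suc (d - n) dvd card (centralizer_of Q q)"
        obtain y where y: "y \<in> C" "e' y \<noteq> 0"
          "card (centralizer_of Q q) * p ^ n = card (centralizer_of ?H y)"
          using ex_centralizer_quotient[OF char e'(1) q] by auto
        have "p ^ Suc d = p ^ Suc (d - n) * p ^ n" using \<open>n \<le> d\<close> by (simp flip: power_add power_Suc)
        also have "\<dots> dvd card (centralizer_of ?H y)" unfolding y(3)[symmetric] using dv by (rule mult_dvd_mono) simp
        also have "\<dots> dvd card (centralizer_of G y)" by (rule card_centralizer_restr_dvd[OF C y(1)])
        finally show False
          using e(3) y subgroup.mem_carrier[OF C y(1)] by (simp add: small_defect_def e'_def restr_def)
      qed
      have "push ?H Q \<phi> (foldr (ga_mult ?H) ws e') = ga_zero"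
        if ws: "set ws \<subseteq> set zs'" "length ws = p ^ (d - n)" for ws
        unfolding push_prod
      proof (rule IH[of n])
        show "ga_mult Q (push ?H Q \<phi> e') (push ?H Q \<phi> e') = push ?H Q \<phi> e'"
          using e'(2) push_mult[of e' e'] by simp
        show "\<forall>z\<in>set (map (push ?H Q \<phi>) ws). class_fun Q z \<and> ga_nilpotent Q z"
          using ws(1) zs' by (auto intro!: push_class_fun push_nilpotent)
      qed (use False \<open>n \<le> d\<close> Q.fin_group_axioms push_class_fun[OF e'(1)] sd ws in auto)
      \<comment> \<open>Source of the bound: p^n - 1 groups of p^(d - n) factors each are required,
        and p^d - p^(d - n) is largest at n = \<epsilon>.\<close>
      moreover have "(p ^ n - 1) * p ^ (d - n) \<le> length zs'"
      proof -
        have "(p ^ n - 1) * p ^ (d - n) = p ^ d - p ^ (d - n)"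
          using \<open>n \<le> d\<close> by (simp add: diff_mult_distrib flip: power_add)
        also have "\<dots> \<le> p ^ d - p ^ (d - \<epsilon>)"
          using \<open>n \<le> \<epsilon>\<close> p2 by (intro diff_le_mono2 power_increasing) auto
        finally show ?thesis using zs(2) by (simp add: zs'_def)
      qed
      ultimately show ?thesis
        using shift_invariant_prod[OF char e', of zs' "p ^ (d - n)" x] zs' xC by simp
    qed
  qed
  then show ?thesis using val[OF xC] val[OF subgroup.m_closed[OF C uC xC]] by simp
qed

text \<open>All factors but the first make the product invariant under p-elements; the first, being
  nilpotent, annihilates it. This accounts for the summand 1.\<close>

lemma prod_eq_0:
  fixes e :: "'a \<Rightarrow> 'f::field"
  assumes p: "prime p" "CHAR('f) = p"
    and e: "class_fun G e" "e \<star> e = e" "small_defect G p d e"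
    and eps: "\<And>x u k. x \<in> carrier G \<Longrightarrow> e x \<noteq> 0 \<Longrightarrow> u \<in> centralizer_of G x \<Longrightarrow>
        u [^] (p ^ k) = \<one> \<Longrightarrow> u [^] (p ^ \<epsilon>) = \<one>"
    and IH: "\<And>n (Q::'a monoid) (e'::'a \<Rightarrow> 'f) ws. 0 < n \<Longrightarrow> n \<le> d \<Longrightarrow> fin_group Q \<Longrightarrow>
        class_fun Q e' \<Longrightarrow> ga_mult Q e' e' = e' \<Longrightarrow> small_defect Q p (d - n) e' \<Longrightarrow>
        \<forall>z\<in>set ws. class_fun Q z \<and> ga_nilpotent Q z \<Longrightarrow> length ws = p ^ (d - n) \<Longrightarrow>
        foldr (ga_mult Q) ws e' = ga_zero"
    and zs: "\<forall>z\<in>set zs. class_fun G z \<and> ga_nilpotent G z" "length zs = p ^ d - p ^ (d - \<epsilon>) + 1"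
  shows "foldr (\<star>) zs e = ga_zero"
proof -
  obtain z ys where zs_eq: "zs = z # ys" using zs(2) by (cases zs) auto
  have "z \<star> foldr (\<star>) ys e = ga_zero"
  proof (rule nilpotent_mult_eq_0[OF p])
    show "class_fun G (foldr (\<star>) ys e)"
      by (rule class_fun_prod) (use zs zs_eq e in auto)
    show "foldr (\<star>) ys e (u \<otimes> x) = foldr (\<star>) ys e x"
      if "u \<in> carrier G" "u [^] (p ^ k) = \<one>" "x \<in> centralizer_of G u" for u k x
      by (rule prod_shift_invariant[OF p e eps IH _ _ that]) (use zs zs_eq in auto)
  qed (use zs zs_eq in auto)
  then show ?thesis by (simp add: zs_eq)
qed

end

text \<open>Every element of a group centralizing a point of the support of \<open>e\<close> that has order a power
  of \<open>p\<close> has order at most \<open>p ^ d\<close>, so \<open>\<epsilon> = d\<close> is always admissible.\<close>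

lemma prod_defect_eq_0:
  fixes e :: "'g \<Rightarrow> 'f::field" and G :: "'g monoid"
  assumes p: "prime p" "CHAR('f) = p" and "fin_group G"
    and "class_fun G e" "ga_mult G e e = e" "small_defect G p d e"
    and "\<forall>z\<in>set zs. class_fun G z \<and> ga_nilpotent G z" "length zs = p ^ d"
  shows "foldr (ga_mult G) zs e = ga_zero"
  using assms(3-)
proof (induction d arbitrary: G e zs rule: less_induct)
  case (less d)
  interpret G: fin_group G by fact
  \<comment> \<open>The choice \<open>\<epsilon> = d\<close> turns the number of factors into
    p^d.\<close>
  have "p ^ d - p ^ (d - d) + 1 = p ^ d" using p(1) prime_gt_0_nat by (simp add: Suc_leI)
  then have len: "length zs = p ^ d - p ^ (d - d) + 1" using less.prems by simp
  show ?case
  proof (rule G.prod_eq_0[OF p less.prems(2-4) _ _ less.prems(5) len])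
    fix x u k assume x: "x \<in> carrier G" "e x \<noteq> 0" and u: "u \<in> centralizer_of G x" "u [^]\<^bsub>G\<^esub> (p ^ k) = \<one>\<^bsub>G\<^esub>"
    have uG: "u \<in> carrier G" using u by (simp add: centralizer_of_def)
    have "G.ord u dvd p ^ k" using G.pow_eq_id[OF uG] u by simp
    then obtain n where n: "G.ord u = p ^ n" using divides_primepow_nat[OF p(1)] by auto
    interpret K: fin_group "restr_grp G (centralizer_of G x)"
      by (rule G.fin_group_restr[OF G.subgroup_centralizer_of[OF x(1)]])
    have "u [^]\<^bsub>G\<^esub> card (centralizer_of G x) = \<one>\<^bsub>G\<^esub>"
      using K.pow_order_eq_1[of u] u by (simp add: Coset.order_def flip: G.nat_pow_consistent)
    then have dv: "p ^ n dvd card (centralizer_of G x)" using G.pow_eq_id[OF uG] n by simp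
    have "n \<le> d"
    proof (rule ccontr)
      assume "\<not> n \<le> d"
      then have "p ^ Suc d dvd p ^ n" by (intro le_imp_power_dvd) simp
      then show False using dv less.prems(4) x dvd_trans by (auto simp: small_defect_def)
    qed
    then show "u [^]\<^bsub>G\<^esub> (p ^ d) = \<one>\<^bsub>G\<^esub>" using G.pow_eq_id[OF uG] n le_imp_power_dvd by simp
  next
    fix n and Q :: "'g monoid" and e' :: "'g \<Rightarrow> 'f" and ws :: "('g \<Rightarrow> 'f) list"
    assume "0 < n" "n \<le> d" "fin_group Q" "class_fun Q e'" "ga_mult Q e' e' = e'"
      "small_defect Q p (d - n) e'" "\<forall>z\<in>set ws. class_fun Q z \<and> ga_nilpotent Q z"
      "length ws = p ^ (d - n)"
    then show "foldr (ga_mult Q) ws e' = ga_zero" by (intro less.IH[of "d - n"]) auto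
  qed
qed

section \<open>The support of a relative trace\<close>

context fin_group
begin

lemma lcoset_eq_iff:
  assumes D: "subgroup D G" and yz: "y \<in> carrier G" "z \<in> carrier G"
  shows "y <# D = z <# D \<longleftrightarrow> inv y \<otimes> z \<in> D"
proof
  assume "y <# D = z <# D"
  moreover have "z \<in> z <# D" using subgroup.one_closed[OF D] yz by (force simp: l_coset_def)
  ultimately obtain h where "h \<in> D" "z = y \<otimes> h" by (auto simp: l_coset_def)
  then show "inv y \<otimes> z \<in> D" using yz subgroup.mem_carrier[OF D] by (simp flip: m_assoc)
next
  assume h: "inv y \<otimes> z \<in> D"
  have "z = y \<otimes> (inv y \<otimes> z)" using yz by (simp flip: m_assoc)
  then have "z \<in> y <# D" using h unfolding l_coset_def by blast
  then show "y <# D = z <# D" by (rule l_repr_independence[OF _ yz(1) D])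
qed

definition trace_term :: "('a \<Rightarrow> 'f::field) \<Rightarrow> 'a \<Rightarrow> 'a set \<Rightarrow> 'f" where
  "trace_term a x C = ga_conj G (SOME g. g \<in> C) a x"

abbreviation lcosets_of :: "'a set \<Rightarrow> 'a set set" where
  "lcosets_of D \<equiv> {g <# D | g. g \<in> carrier G}"

lemma rel_trace_eq: "rel_trace G D a x = sum (trace_term a x) (lcosets_of D)"
  by (simp add: rel_trace_def trace_term_def)

lemma finite_lcosets_of: "finite (lcosets_of D)"
proof -
  have "lcosets_of D = (\<lambda>g. g <# D) ` carrier G" by auto
  then show ?thesis by simp
qed

text \<open>\<open>rel_trace\<close> evaluates at a chosen representative of the coset. Any other
  representative differs by an element of D, and D fixes a.\<close>

lemma trace_term_eq:
  assumes D: "subgroup D G" and a: "a \<in> fixed_pts G D"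
    and x: "x \<in> carrier G" and g: "g \<in> carrier G"
  shows "trace_term a x (g <# D) = a (inv g \<otimes> x \<otimes> g)"
proof -
  define s where "s = (SOME s. s \<in> g <# D)"
  have "g \<otimes> \<one> \<in> g <# D" using subgroup.one_closed[OF D] unfolding l_coset_def by blast
  then have "s \<in> g <# D" unfolding s_def by (rule someI)
  then obtain h where h: "h \<in> D" "s = g \<otimes> h" by (auto simp: l_coset_def)
  have hG: "h \<in> carrier G" using subgroup.mem_carrier[OF D h(1)] .
  have "ga_conj G h a = a" using a h(1) by (simp add: fixed_pts_def)
  then have "a (inv g \<otimes> x \<otimes> g) = ga_conj G h a (inv g \<otimes> x \<otimes> g)" by simp
  also have "\<dots> = a (inv h \<otimes> (inv g \<otimes> x \<otimes> g) \<otimes> h)"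
    using x g by (simp add: ga_conj_def)
  also have "inv h \<otimes> (inv g \<otimes> x \<otimes> g) \<otimes> h = inv s \<otimes> x \<otimes> s"
    using x g hG h(2) by (simp add: inv_mult_group m_assoc)
  finally show ?thesis using x by (simp add: trace_term_def ga_conj_def s_def)
qed

text \<open>Makes the trace at x an invariant sum for the action of the centralizer of x on the
  cosets of D; both support lemmas below rest on this action.\<close>

lemma trace_term_centralizer:
  assumes D: "subgroup D G" and a: "a \<in> fixed_pts G D"
    and x: "x \<in> carrier G" and c: "c \<in> centralizer_of G x" and g: "g \<in> carrier G"
  shows "trace_term a x (c \<otimes> g <# D) = trace_term a x (g <# D)"
proof -
  from c have cG: "c \<in> carrier G" and cx: "x \<otimes> c = c \<otimes> x" by (auto simp: centralizer_of_def)
  have "inv (c \<otimes> g) \<otimes> x \<otimes> (c \<otimes> g) = inv g \<otimes> (inv c \<otimes> (x \<otimes> c) \<otimes> g)"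
    using cG x g by (simp add: inv_mult_group m_assoc)
  also have "\<dots> = inv g \<otimes> x \<otimes> g"
    unfolding cx using cG x g by (simp add: m_assoc[symmetric])
  finally show ?thesis using cG g by (simp add: trace_term_eq[OF D a x])
qed

text \<open>The p-element u permutes the cosets of D with p-power period. A nonzero trace forces a
  fixed coset g D, so g^-1 u g lies in D and obeys the exponent of D.\<close>

lemma rel_trace_support_exponent:
  fixes a :: "'a \<Rightarrow> 'f::field"
  assumes p: "prime p" "CHAR('f) = p"
    and D: "subgroup D G" and a: "a \<in> fixed_pts G D" and x: "x \<in> carrier G"
    and ne: "rel_trace G D a x \<noteq> 0"
    and u: "u \<in> centralizer_of G x" "u [^] (p ^ k) = \<one>"
    and E: "\<And>h. h \<in> D \<Longrightarrow> h [^] (n::nat) = \<one>"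
  shows "u [^] n = \<one>"
proof -
  have uG: "u \<in> carrier G" using u by (simp add: centralizer_of_def)
  define \<sigma> where "\<sigma> C = u <# C" for C
  have \<sigma>: "\<sigma> (g <# D) = u \<otimes> g <# D" if "g \<in> carrier G" for g
    unfolding \<sigma>_def by (rule lcos_m_assoc[OF subgroup.subset[OF D] uG that])
  have it: "(\<sigma> ^^ i) (g <# D) = u [^] i \<otimes> g <# D" if "g \<in> carrier G" for g i
  proof (induction i)
    case (Suc i)
    then show ?case using nat_pow_Suc2[OF uG, of i] that uG by (simp add: \<sigma> m_assoc del: nat_pow_Suc)
  qed (use that in simp)
  have "rel_trace G D a x = sum (trace_term a x) {C \<in> lcosets_of D. \<sigma> C = C}"
    unfolding rel_trace_eq
  proof (rule sum_prime_power_period[OF finite_lcosets_of p, where k = k])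
    fix C assume "C \<in> lcosets_of D"
    then obtain g where g: "g \<in> carrier G" "C = g <# D" by auto
    show "\<sigma> C \<in> lcosets_of D" using \<sigma>[OF g(1)] g uG by auto
    show "(\<sigma> ^^ (p ^ k)) C = C" using it[OF g(1), of "p ^ k"] g u(2) by simp
    show "trace_term a x (\<sigma> C) = trace_term a x C"
      using trace_term_centralizer[OF D a x u(1) g(1)] \<sigma>[OF g(1)] g(2) by simp
  qed
  then have "{C \<in> lcosets_of D. \<sigma> C = C} \<noteq> {}" using ne by (metis sum.empty)
  then obtain g where g: "g \<in> carrier G" "\<sigma> (g <# D) = g <# D" by auto
  have "u \<otimes> g <# D = g <# D" using \<sigma>[OF g(1)] g(2) by simp
  then have "inv g \<otimes> (u \<otimes> g) \<in> D"
    using lcoset_eq_iff[OF D, of g "u \<otimes> g"] g(1) uG by simp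
  then have "(inv g \<otimes> (u \<otimes> g)) [^] n = \<one>" by (rule E)
  moreover have "(inv g \<otimes> (u \<otimes> g)) [^] i = inv g \<otimes> (u [^] i \<otimes> g)" for i :: nat
  proof (induction i)
    case (Suc i)
    have "inv g \<otimes> (u [^] i \<otimes> g) \<otimes> (inv g \<otimes> (u \<otimes> g)) = inv g \<otimes> (u [^] i \<otimes> (g \<otimes> inv g) \<otimes> (u \<otimes> g))"
      using g(1) uG by (simp only: m_assoc m_closed inv_closed nat_pow_closed)
    then show ?case using Suc g(1) uG by (simp add: m_assoc)
  qed (use g in simp)
  ultimately have 1: "inv g \<otimes> (u [^] n \<otimes> g) = \<one>" by simp
  have "u [^] n = g \<otimes> (inv g \<otimes> (u [^] n \<otimes> g)) \<otimes> inv g"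
    using g(1) uG by (simp add: m_assoc) (simp flip: m_assoc)
  then show ?thesis unfolding 1 using g(1) by simp
qed

text \<open>Let K be the centralizer of x. The stabilizer in K of a coset g D is K \<inter> g D
  g^-1, of order at most p^d. If p^(d+1) divided |K|, every K-orbit of cosets would have size
  divisible by p and the trace at x would vanish.\<close>

lemma rel_trace_small_defect:
  fixes a :: "'a \<Rightarrow> 'f::field"
  assumes p: "prime p" "CHAR('f) = p"
    and D: "subgroup D G" "card D = p ^ d" and a: "a \<in> fixed_pts G D"
  shows "small_defect G p d (rel_trace G D a)"
  unfolding small_defect_def
proof (intro ballI impI notI)
  fix x assume x: "x \<in> carrier G" and ne: "rel_trace G D a x \<noteq> 0"
  define K where "K = centralizer_of G x"
  assume dv: "p ^ Suc d dvd card (centralizer_of G x)"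
  have K: "subgroup K G" unfolding K_def by (rule subgroup_centralizer_of[OF x])
  have KG: "k \<in> carrier G" if "k \<in> K" for k using subgroup.mem_carrier[OF K that] .
  have finK: "finite K" by (rule finite_subset[OF subgroup.subset[OF K] fin])
  define orb where "orb C = (\<lambda>k. k <# C) ` K" for C
  have act: "k <# (g <# D) = k \<otimes> g <# D" if "k \<in> K" "g \<in> carrier G" for k g
    by (rule lcos_m_assoc[OF subgroup.subset[OF D(1)] KG[OF that(1)] that(2)])
  have act2: "k <# (l <# (g <# D)) = k \<otimes> l <# (g <# D)" if "k \<in> K" "l \<in> K" "g \<in> carrier G" for k l g
    using act[OF that(1), of "l \<otimes> g"] act[OF that(2,3)] act[OF subgroup.m_closed[OF K that(1,2)] that(3)]
      that KG by (simp add: m_assoc)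
  have mem_orb: "C' \<in> orb C \<longleftrightarrow> orb C' = orb C"
    if C: "C \<in> lcosets_of D" "C' \<in> lcosets_of D" for C C'
  proof
    obtain g where g: "g \<in> carrier G" "C = g <# D" using C(1) by auto
    assume "C' \<in> orb C"
    then obtain l where l: "l \<in> K" "C' = l <# C" by (auto simp: orb_def)
    have "orb C' = (\<lambda>k. k \<otimes> l <# C) ` K"
      unfolding orb_def l(2) g(2) by (rule image_cong[OF refl]) (use act2 l(1) g(1) in simp)
    also have "\<dots> = (\<lambda>k. k <# C) ` ((\<lambda>k. k \<otimes> l) ` K)" by (simp add: image_image)
    also have "(\<lambda>k. k \<otimes> l) ` K = K"
    proof (intro equalityI subsetI)
      fix k assume k: "k \<in> K"
      then have "k = (k \<otimes> inv l) \<otimes> l" using l(1) KG by (simp add: m_assoc)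
      then show "k \<in> (\<lambda>k. k \<otimes> l) ` K"
        using subgroup.m_closed[OF K k subgroup.m_inv_closed[OF K l(1)]] by blast
    qed (use subgroup.m_closed[OF K _ l(1)] in auto)
    finally show "orb C' = orb C" by (simp add: orb_def)
  next
    obtain g where g: "g \<in> carrier G" "C' = g <# D" using C(2) by auto
    have "\<one> <# C' = C'" using act[OF subgroup.one_closed[OF K] g(1)] g by simp
    then have "C' \<in> orb C'" unfolding orb_def using subgroup.one_closed[OF K] by (metis image_eqI)
    then show "C' \<in> orb C" if "orb C' = orb C" using that by simp
  qed
  have "sum (trace_term a x) (lcosets_of D) = 0"
  proof (rule sum_fibres_eq_0[OF finite_lcosets_of, where c = orb])
    fix C assume C: "C \<in> lcosets_of D"
    then obtain g where g: "g \<in> carrier G" "C = g <# D" by auto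
    have orb_sub: "orb C \<subseteq> lcosets_of D" using act g KG by (fastforce simp: orb_def)
    have eq: "{y \<in> lcosets_of D. orb y = orb C} = orb C"
      using mem_orb[OF C] orb_sub by blast
    \<comment> \<open>The stabilizer of C in K. The map k -> k C has the left cosets of
      \<open>S\<close> as fibres, which yields |K| = |orbit| * |S|.\<close>
    define S where "S = {k \<in> K. inv g \<otimes> (k \<otimes> g) \<in> D}"
    have fibre: "{k \<in> K. k <# C = O'} = (\<lambda>s. k0 \<otimes> s) ` S" if k0: "k0 \<in> K" "O' = k0 <# C" for k0 O'
    proof -
      have iff: "k <# C = k0 <# C \<longleftrightarrow> inv k0 \<otimes> k \<in> S" if k: "k \<in> K" for k
      proof -
        have "k <# C = k0 <# C \<longleftrightarrow> k0 \<otimes> g <# D = k \<otimes> g <# D"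
          using act[OF k g(1)] act[OF k0(1) g(1)] g(2) by auto
        also have "\<dots> \<longleftrightarrow> inv (k0 \<otimes> g) \<otimes> (k \<otimes> g) \<in> D"
          by (rule lcoset_eq_iff[OF D(1)]) (use k k0 g KG in auto)
        also have "inv (k0 \<otimes> g) \<otimes> (k \<otimes> g) = inv g \<otimes> ((inv k0 \<otimes> k) \<otimes> g)"
          using KG[OF k] KG[OF k0(1)] g(1) by (simp add: inv_mult_group m_assoc)
        finally show ?thesis
          using subgroup.m_closed[OF K subgroup.m_inv_closed[OF K k0(1)] k] by (simp add: S_def)
      qed
      show ?thesis
      proof (intro equalityI subsetI)
        fix k assume "k \<in> {k \<in> K. k <# C = O'}"
        then have "k \<in> K" "inv k0 \<otimes> k \<in> S" using iff k0 by auto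
        moreover have "k = k0 \<otimes> (inv k0 \<otimes> k)" using calculation(1) k0(1) KG by (simp flip: m_assoc)
        ultimately show "k \<in> (\<lambda>s. k0 \<otimes> s) ` S" by blast
      next
        fix k assume "k \<in> (\<lambda>s. k0 \<otimes> s) ` S"
        then obtain s where s: "s \<in> S" "k = k0 \<otimes> s" by auto
        then have sK: "s \<in> K" by (simp add: S_def)
        have "k \<in> K" using s(2) subgroup.m_closed[OF K k0(1) sK] by simp
        moreover have "inv k0 \<otimes> k = s" using s(2) KG[OF sK] KG[OF k0(1)] by (simp flip: m_assoc)
        ultimately show "k \<in> {k \<in> K. k <# C = O'}" using iff s(1) k0(2) by simp
      qed
    qed
    have card_fibre: "card {k \<in> K. k <# C = O'} = card S" if O': "O' \<in> orb C" for O'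
    proof -
      obtain k0 where k0: "k0 \<in> K" "O' = k0 <# C" using O' by (auto simp: orb_def)
      have "inj_on (\<lambda>s. k0 \<otimes> s) S"
        using KG k0(1) by (auto simp: inj_on_def S_def)
      then show ?thesis unfolding fibre[OF k0] by (rule card_image)
    qed
    have "card K = card (\<Union>O'\<in>orb C. {k \<in> K. k <# C = O'})"
      by (rule arg_cong[of _ _ card]) (auto simp: orb_def)
    also have "\<dots> = (\<Sum>O'\<in>orb C. card {k \<in> K. k <# C = O'})"
      by (rule card_UN_disjoint) (use finK in \<open>auto simp: orb_def\<close>)
    also have "\<dots> = card (orb C) * card S" by (simp add: card_fibre)
    finally have cardK: "card K = card (orb C) * card S" .
    define x' where "x' = inv g \<otimes> (x \<otimes> g)"
    have x': "x' \<in> carrier G" using x g by (simp add: x'_def)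
    \<comment> \<open>Conjugation by g moves \<open>S\<close> onto a subgroup of D, so that Lagrange
      in D makes its order a power of p.\<close>
    have "bij_betw (\<lambda>k. inv g \<otimes> (k \<otimes> g)) S (D \<inter> centralizer_of G x')"
    proof (rule bij_betw_byWitness[where f' = "\<lambda>h. g \<otimes> (h \<otimes> inv g)"])
      have DG: "h \<in> carrier G" if "h \<in> D" for h using subgroup.mem_carrier[OF D(1) that] .
      have c1: "g \<otimes> (inv g \<otimes> k) = k" "inv g \<otimes> (g \<otimes> k) = k" if "k \<in> carrier G" for k
        using that g(1) by (simp_all flip: m_assoc)
      show "\<forall>k\<in>S. g \<otimes> (inv g \<otimes> (k \<otimes> g) \<otimes> inv g) = k"
        using KG g(1) by (auto simp: S_def m_assoc c1)
      show "\<forall>h\<in>D \<inter> centralizer_of G x'. inv g \<otimes> (g \<otimes> (h \<otimes> inv g) \<otimes> g) = h"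
        using DG g(1) by (auto simp: m_assoc c1)
      show "(\<lambda>k. inv g \<otimes> (k \<otimes> g)) ` S \<subseteq> D \<inter> centralizer_of G x'"
      proof (rule image_subsetI)
        fix k assume k: "k \<in> S"
        then have kG: "k \<in> carrier G" and kx: "k \<otimes> x = x \<otimes> k" and kD: "inv g \<otimes> (k \<otimes> g) \<in> D"
          by (auto simp: S_def K_def centralizer_of_def)
        have "inv g \<otimes> (k \<otimes> g) \<otimes> x' = inv g \<otimes> ((k \<otimes> x) \<otimes> g)"
          using kG x g(1) by (simp add: x'_def m_assoc c1)
        also have "\<dots> = x' \<otimes> (inv g \<otimes> (k \<otimes> g))"
          unfolding kx using kG x g(1) by (simp add: x'_def m_assoc c1)
        finally show "inv g \<otimes> (k \<otimes> g) \<in> D \<inter> centralizer_of G x'"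
          using kD kG g(1) by (simp add: centralizer_of_def)
      qed
      show "(\<lambda>h. g \<otimes> (h \<otimes> inv g)) ` (D \<inter> centralizer_of G x') \<subseteq> S"
      proof (rule image_subsetI)
        fix h assume h: "h \<in> D \<inter> centralizer_of G x'"
        then have hG: "h \<in> carrier G" and hx: "h \<otimes> x' = x' \<otimes> h" and hD: "h \<in> D"
          by (auto simp: centralizer_of_def)
        have xx': "x = g \<otimes> (x' \<otimes> inv g)" using x g(1) by (simp add: x'_def m_assoc c1)
        have "g \<otimes> (h \<otimes> inv g) \<otimes> x = g \<otimes> ((h \<otimes> x') \<otimes> inv g)"
          unfolding xx' using hG x' g(1) by (simp add: m_assoc c1)
        also have "\<dots> = x \<otimes> (g \<otimes> (h \<otimes> inv g))"
          unfolding hx xx' using hG x' g(1) by (simp add: m_assoc c1)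
        finally show "g \<otimes> (h \<otimes> inv g) \<in> S"
          using hD hG g(1) by (simp add: S_def K_def centralizer_of_def m_assoc c1)
      qed
    qed
    then have "card S = card (D \<inter> centralizer_of G x')" by (rule bij_betw_same_card)
    also have "\<dots> dvd card D"
    proof -
      have "subgroup (D \<inter> centralizer_of G x') G"
        by (rule subgroups_Inter_pair[OF D(1) subgroup_centralizer_of[OF x']])
      then have "subgroup (D \<inter> centralizer_of G x') (restr_grp G D)"
        by (rule subgroup_incl[OF _ D(1)]) simp
      from group.lagrange[OF subgroup_imp_group[OF D(1)] this]
      have "card D = card (D \<inter> centralizer_of G x') *
          card (rcosets\<^bsub>restr_grp G D\<^esub> (D \<inter> centralizer_of G x'))"
        by (simp add: Coset.order_def mult.commute)
      then show ?thesis by (rule dvdI)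
    qed
    finally obtain j where j: "j \<le> d" "card S = p ^ j"
      using D(2) divides_primepow_nat[OF p(1)] by auto
    have "p ^ j * p dvd p ^ j * card (orb C)"
    proof -
      have "p ^ j * p dvd p ^ Suc d" using j(1) by (simp add: le_imp_power_dvd flip: power_Suc2)
      also have "\<dots> dvd card (orb C) * p ^ j" using dv cardK j(2) by (simp add: K_def)
      finally show ?thesis by (simp add: mult.commute)
    qed
    then have "p dvd card (orb C)" using p(1) by (simp add: prime_gt_0_nat)
    then show "CHAR('f) dvd card {y \<in> lcosets_of D. orb y = orb C}" unfolding eq p(2) .
    show "trace_term a x C' = trace_term a x C"
      if C': "C' \<in> lcosets_of D" "orb C' = orb C" for C'
    proof -
      have "C' \<in> orb C" using mem_orb[OF C C'(1)] C'(2) by simp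
      then obtain k where k: "k \<in> K" "C' = k <# C" by (auto simp: orb_def)
      then show ?thesis
        using trace_term_centralizer[OF D(1) a x _ g(1), of k] act[OF k(1) g(1)] g(2) by (simp add: K_def)
    qed
  qed
  then show False using ne by (simp add: rel_trace_eq)
qed

end

section \<open>The radical of the center of a block\<close>

text \<open>Gaussian elimination, one coordinate s at a time: more vectors than coordinates admit a
  nontrivial relation.\<close>

lemma ex_linear_dependence:
  fixes v :: "'i \<Rightarrow> 'x \<Rightarrow> 'f::field"
  assumes "finite S" "finite I" "card S < card I"
  shows "\<exists>c. (\<exists>i\<in>I. c i \<noteq> 0) \<and> (\<forall>x\<in>S. (\<Sum>i\<in>I. c i * v i x) = 0)"
  using assms
proof (induction S arbitrary: I v rule: finite_induct)
  case empty
  then have "I \<noteq> {}" by auto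
  then show ?case by (intro exI[of _ "\<lambda>_. 1"]) auto
next
  case (insert s S)
  show ?case
  proof (cases "\<forall>i\<in>I. v i s = 0")
    case True
    have "card S < card I" using insert.hyps insert.prems(2) by simp
    then obtain c where "\<exists>i\<in>I. c i \<noteq> 0" "\<forall>x\<in>S. (\<Sum>i\<in>I. c i * v i x) = 0"
      using insert.IH[OF insert.prems(1), of v] by blast
    then show ?thesis using True by (intro exI[of _ c]) auto
  next
    case False
    then obtain j where j: "j \<in> I" "v j s \<noteq> 0" by blast
    \<comment> \<open>Subtracting multiples of the pivot vector v j clears the coordinate s.\<close>
    define w where "w i x = v i x - v i s / v j s * v j x" for i x
    have "card S < card (I - {j})" using insert.hyps insert.prems j(1) by simp
    then obtain c where c: "\<exists>i\<in>I - {j}. c i \<noteq> 0"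
      "\<forall>x\<in>S. (\<Sum>i\<in>I - {j}. c i * w i x) = 0"
      using insert.IH[of "I - {j}" w] insert.prems(1) by auto
    \<comment> \<open>The coefficient at j collects the multiples of v j that were subtracted in
      \<open>w\<close>.\<close>
    define c' where "c' i = (if i = j then - (\<Sum>i\<in>I - {j}. c i * v i s / v j s) else c i)" for i
    have val: "(\<Sum>i\<in>I. c' i * v i x) = (\<Sum>i\<in>I - {j}. c i * w i x)" for x
    proof -
      have "(\<Sum>i\<in>I. c' i * v i x) = c' j * v j x + (\<Sum>i\<in>I - {j}. c' i * v i x)"
        by (rule sum.remove[OF insert.prems(1) j(1)])
      also have "(\<Sum>i\<in>I - {j}. c' i * v i x) = (\<Sum>i\<in>I - {j}. c i * v i x)"
        by (rule sum.cong) (auto simp: c'_def)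
      also have "c' j * v j x = - (\<Sum>i\<in>I - {j}. c i * (v i s / v j s * v j x))"
        by (simp add: c'_def sum_distrib_right mult.assoc)
      finally show ?thesis by (simp add: w_def right_diff_distrib sum_subtractf)
    qed
    have "w i s = 0" for i using j(2) by (simp add: w_def)
    then have "(\<Sum>i\<in>I. c' i * v i x) = 0" if "x \<in> insert s S" for x
      using that c(2) unfolding val by auto
    moreover have "\<exists>i\<in>I. c' i \<noteq> 0" using c(1) by (auto simp: c'_def)
    ultimately show ?thesis by blast
  qed
qed

context fin_group
begin

lemma ga_center_grp_alg: "ga_center G (grp_alg G) = {z. class_fun G z}"
  unfolding ga_center_def using class_funI class_fun_commute class_fun_in by blast

lemma lincomb_in:
  "(\<And>i. i \<in> I \<Longrightarrow> v i \<in> grp_alg G) \<Longrightarrow> (\<lambda>x. \<Sum>i\<in>I. c i * v i x) \<in> grp_alg G"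
  by (auto simp: grp_alg_def)

lemma class_fun_lincomb:
  assumes "\<And>i. i \<in> I \<Longrightarrow> class_fun G (v i)"
  shows "class_fun G (\<lambda>x. \<Sum>i\<in>I. c i * v i x)"
  unfolding class_fun_def
  using lincomb_in[of I v c] assms by (auto intro!: sum.cong simp: class_fun_def)

lemma ga_mult_lincomb:
  "a \<star> (\<lambda>x. \<Sum>i\<in>I. c i * v i x) = (\<lambda>x. \<Sum>i\<in>I. c i * (a \<star> v i) x)"
proof (rule grp_alg_eqI)
  fix x assume x: "x \<in> carrier G"
  have "(a \<star> (\<lambda>x. \<Sum>i\<in>I. c i * v i x)) x
      = (\<Sum>y\<in>carrier G. \<Sum>i\<in>I. c i * (a y * v i (inv y \<otimes> x)))"
    by (simp add: ga_mult_apply x sum_distrib_left mult.left_commute)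
  also have "\<dots> = (\<Sum>i\<in>I. c i * (a \<star> v i) x)"
    by (subst sum.swap) (simp add: ga_mult_apply x sum_distrib_left)
  finally show "(a \<star> (\<lambda>x. \<Sum>i\<in>I. c i * v i x)) x = (\<Sum>i\<in>I. c i * (a \<star> v i) x)" .
qed (auto intro: lincomb_in)

lemma prod_lincomb:
  "foldr (\<star>) ws (\<lambda>x. \<Sum>i\<in>I. c i * v i x) = (\<lambda>x. \<Sum>i\<in>I. c i * foldr (\<star>) ws (v i) x)"
  by (induction ws) (simp_all add: ga_mult_lincomb)

lemma class_fun_add:
  "class_fun G a \<Longrightarrow> class_fun G b \<Longrightarrow> class_fun G (\<lambda>x. a x + b x)"
  by (auto simp: class_fun_def grp_alg_def)

lemma class_fun_scale: "class_fun G a \<Longrightarrow> class_fun G (\<lambda>x. c * a x)"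
  by (auto simp: class_fun_def grp_alg_def)

lemma ga_mult_add: "a \<star> (\<lambda>x. b x + c x) = (\<lambda>x. (a \<star> b) x + (a \<star> c) x)"
  by (auto simp: ga_mult_def distrib_left sum.distrib fun_eq_iff)

lemma ga_mult_scale: "a \<star> (\<lambda>x. r * b x) = (\<lambda>x. r * (a \<star> b) x)"
  by (auto simp: ga_mult_def sum_distrib_left mult.left_commute fun_eq_iff)

lemma add_ga_mult: "(\<lambda>x. a x + b x) \<star> c = (\<lambda>x. (a \<star> c) x + (b \<star> c) x)"
  by (auto simp: ga_mult_def distrib_right sum.distrib fun_eq_iff)

lemma scale_ga_mult: "(\<lambda>x. r * a x) \<star> b = (\<lambda>x. r * (a \<star> b) x)"
  by (auto simp: ga_mult_def sum_distrib_left mult.assoc fun_eq_iff)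

end

section \<open>The center of a block is local, with the nilpotent elements as maximal ideal\<close>

locale block = fin_group G for G (structure) +
  fixes e :: "'a \<Rightarrow> 'f::field"
  assumes block_idem: "block_idem G e"
begin

lemma e_class: "class_fun G e" and e_idem: "e \<star> e = e" and e_nonzero: "e \<noteq> ga_zero"
  and e_primitive: "class_fun G f \<Longrightarrow> f \<star> f = f \<Longrightarrow> f \<star> e = f \<Longrightarrow> f = ga_zero \<or> f = e"
  using block_idem by (auto simp: block_idem_def ga_center_grp_alg)

abbreviation center :: "('a \<Rightarrow> 'f) set" where
  "center \<equiv> ga_center G (block_alg G e)"

text \<open>An element that is central in eFG is central in FG, because z = z e = e z reduces its
  products with b to products with e b, which lies in eFG.\<close>

lemma center_iff: "z \<in> center \<longleftrightarrow> class_fun G z \<and> e \<star> z = z"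
proof
  assume "z \<in> center"
  then have "z \<in> block_alg G e" and comm: "z \<star> b = b \<star> z" if "b \<in> block_alg G e" for b
    using that by (auto simp: ga_center_def)
  then obtain a where a: "a \<in> grp_alg G" "z = e \<star> a"
    using \<open>z \<in> center\<close> by (auto simp: ga_center_def block_alg_def)
  then have ez: "e \<star> z = z" by (simp add: e_idem flip: ga_mult_assoc)
  then have ze: "z \<star> e = z" by (simp add: class_fun_commute[OF e_class, of z])
  have "z \<star> b = b \<star> z" if "b \<in> grp_alg G" for b
  proof -
    have "e \<star> b \<in> block_alg G e" using that by (auto simp: block_alg_def)
    then have "z \<star> (e \<star> b) = (e \<star> b) \<star> z" by (rule comm)
    then have "z \<star> b = e \<star> (b \<star> z)" by (simp add: ze ga_mult_assoc flip: ga_mult_assoc[of z e])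
    also have "\<dots> = b \<star> z" by (simp add: class_fun_commute[OF e_class, of "b \<star> z"] ga_mult_assoc ze)
    finally show ?thesis .
  qed
  then show "class_fun G z \<and> e \<star> z = z" using ez a(2) by (auto intro: class_funI)
next
  assume z: "class_fun G z \<and> e \<star> z = z"
  then have "z \<in> block_alg G e" unfolding block_alg_def using class_fun_in[of z] by force
  then show "z \<in> center" using z class_fun_commute[of z] by (simp add: ga_center_def)
qed

lemma center_e: "z \<in> center \<Longrightarrow> z \<star> e = z"
  using class_fun_commute[OF e_class, of z] by (simp add: center_iff)

lemma e_in_center: "e \<in> center"
  by (simp add: center_iff e_class e_idem)

lemma center_mult: "a \<in> center \<Longrightarrow> b \<in> center \<Longrightarrow> a \<star> b \<in> center"
  by (simp add: center_iff class_fun_mult flip: ga_mult_assoc)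

lemma center_pow: "a \<in> center \<Longrightarrow> b \<in> center \<Longrightarrow> (ga_mult G a ^^ n) b \<in> center"
  by (induction n) (simp_all add: center_mult)

lemma nilpotent_if_pow: "z \<in> center \<Longrightarrow> (ga_mult G z ^^ n) e = ga_zero \<Longrightarrow> ga_nilpotent G z"
  using pow_mult_right[of n z e z] unfolding ga_nilpotent_def by (metis center_iff ga_mult_zero(2))

text \<open>A linear dependence between the powers of \<open>z\<close> yields \<open>z\<^sup>k = z\<^sup>k z h\<close> for some \<open>k \<ge> 1\<close>; then
  \<open>(z h)\<^sup>k\<close> is an idempotent, which is \<open>0\<close> or \<open>e\<close> by primitivity.\<close>

lemma nilpotent_or_invertible:
  assumes z: "z \<in> center" and nn: "\<not> ga_nilpotent G z"
  obtains y where "y \<in> center" "z \<star> y = e"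
proof -
  define P where "P n = (ga_mult G z ^^ n) e" for n
  have P: "P n \<in> center" for n unfolding P_def by (rule center_pow[OF z e_in_center])
  have P_Suc: "P (Suc n) = z \<star> P n" for n by (simp add: P_def)
  have P_add: "P (m + n) = P m \<star> P n" for m n
  proof (induction m)
    case 0
    then show ?case using P[of n] by (simp add: P_def center_iff)
  next
    case (Suc m)
    then show ?case by (simp add: P_Suc ga_mult_assoc)
  qed
  define N where "N = card (carrier G)"
  obtain c where c: "\<exists>i\<in>{..N}. c i \<noteq> 0" "\<forall>x\<in>carrier G. (\<Sum>i\<in>{..N}. c i * P i x) = 0"
    using ex_linear_dependence[of "carrier G" "{..N}" P] by (auto simp: N_def)
  define k where "k = (LEAST i. i \<le> N \<and> c i \<noteq> 0)"
  have k: "k \<le> N" "c k \<noteq> 0" using LeastI_ex[of "\<lambda>i. i \<le> N \<and> c i \<noteq> 0"] c(1) by (auto simp: k_def)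
  have less_k: "c i = 0" if "i < k" for i
    using not_less_Least[of i "\<lambda>i. i \<le> N \<and> c i \<noteq> 0"] that k(1) by (auto simp: k_def)
  \<comment> \<open>Solve the relation for z^k, the lowest power that occurs in it, and take a
    factor z^(k+1) out of all the other terms.\<close>
  define h where "h = (\<lambda>x. \<Sum>i\<in>{k<..N}. (- c i / c k) * P (i - Suc k) x)"
  have h: "h \<in> center"
    unfolding center_iff
  proof
    show "class_fun G h" unfolding h_def by (rule class_fun_lincomb) (use P in \<open>simp add: center_iff\<close>)
    show "e \<star> h = h" unfolding h_def ga_mult_lincomb using P by (simp add: center_iff)
  qed
  have "P k = P (Suc k) \<star> h"
  proof (rule grp_alg_eqI)
    show "P k \<in> grp_alg G" using P[of k] class_fun_in by (auto simp: center_iff)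
    fix x assume x: "x \<in> carrier G"
    have "(P (Suc k) \<star> h) x = (\<Sum>i\<in>{k<..N}. (- c i / c k) * P i x)"
      unfolding h_def ga_mult_lincomb
      by (rule sum.cong[OF refl]) (simp flip: P_add)
    also have "\<dots> = - (\<Sum>i\<in>{k<..N}. c i * P i x) / c k"
      by (simp add: sum_negf sum_divide_distrib)
    also have "(\<Sum>i\<in>{k<..N}. c i * P i x) = - (c k * P k x)"
    proof -
      have "0 = (\<Sum>i\<in>{..N}. c i * P i x)" using c(2) x by simp
      also have "\<dots> = (\<Sum>i\<in>{k..N}. c i * P i x)"
        by (rule sum.mono_neutral_right) (use less_k in auto)
      also have "\<dots> = c k * P k x + (\<Sum>i\<in>{k<..N}. c i * P i x)"
        using k(1) by (simp add: sum.head)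
      finally show ?thesis by (simp add: eq_neg_iff_add_eq_0 add.commute)
    qed
    finally show "P k x = (P (Suc k) \<star> h) x" using k(2) by simp
  qed simp
  moreover have "P (Suc k) = z \<star> P k" by (rule P_Suc)
  ultimately have Pk: "P (Suc k) = P (Suc k) \<star> z \<star> h"
    by (metis P_add P_def add.commute funpow_0 ga_mult_assoc class_fun_commute z center_iff)
  define r where "r = z \<star> h"
  define R where "R n = (ga_mult G r ^^ n) e" for n
  define H where "H n = (ga_mult G h ^^ n) e" for n
  have r: "r \<in> center" unfolding r_def by (rule center_mult[OF z h])
  have R: "R n \<in> center" for n unfolding R_def by (rule center_pow[OF r e_in_center])
  have H: "H n \<in> center" for n unfolding H_def by (rule center_pow[OF h e_in_center])
  have zc: "class_fun G z" using z by (simp add: center_iff)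
  have RPH: "R n = P n \<star> H n" for n
  proof -
    have "R n = (ga_mult G z ^^ n) (H n)" unfolding R_def r_def H_def by (rule ga_pow_mult_central[OF zc])
    also have "H n = e \<star> H n" using H[of n] by (simp add: center_iff)
    finally show ?thesis by (simp add: P_def pow_mult_right)
  qed
  \<comment> \<open>k may be 0. The positive exponent k + 1 ensures that \<open>R ?k = e\<close>
    exhibits e as a multiple of z.\<close>
  let ?k = "Suc k"
  have PR: "P ?k \<star> R n = P ?k" for n
  proof (induction n)
    case 0
    then show ?case using center_e[OF P] by (simp add: R_def)
  next
    case (Suc n)
    have "P ?k \<star> R (Suc n) = (P ?k \<star> r) \<star> R n" by (simp add: R_def ga_mult_assoc)
    then show ?case using Pk Suc by (simp add: r_def)
  qed
  have comm: "P ?k \<star> H ?k = H ?k \<star> P ?k"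
    using class_fun_commute[of "P ?k" "H ?k"] P[of ?k] by (simp add: center_iff)
  have "R ?k \<star> R ?k = (H ?k \<star> P ?k) \<star> R ?k" by (subst (1) RPH) (simp only: comm)
  also have "\<dots> = H ?k \<star> (P ?k \<star> R ?k)" by (rule ga_mult_assoc)
  also have "\<dots> = R ?k" by (simp only: PR comm[symmetric] RPH[symmetric])
  finally have "R ?k = ga_zero \<or> R ?k = e"
    using e_primitive[of "R ?k"] R[of ?k] center_e[OF R] by (simp add: center_iff)
  then show thesis
  proof
    assume "R ?k = ga_zero"
    then have "P ?k = ga_zero" using PR[of ?k] by simp
    then show thesis using nilpotent_if_pow[OF z, of ?k] nn by (simp add: P_def)
  next
    assume "R ?k = e"
    then have "z \<star> (P k \<star> H ?k) = e" using RPH[of ?k] P_Suc[of k] by (simp add: ga_mult_assoc)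
    then show thesis using that center_mult[OF P H] by blast
  qed
qed

abbreviation nil_center :: "('a \<Rightarrow> 'f) set" where
  "nil_center \<equiv> {z \<in> center. ga_nilpotent G z}"

lemma e_not_nilpotent: "\<not> ga_nilpotent G e"
proof -
  have "(ga_mult G e ^^ n) e = e" for n by (induction n) (simp_all add: e_idem)
  then show ?thesis using e_nonzero by (simp add: ga_nilpotent_def)
qed

lemma nil_center_mult:
  assumes "a \<in> center" "z \<in> nil_center"
  shows "a \<star> z \<in> nil_center"
proof -
  obtain n where n: "(ga_mult G z ^^ n) z = ga_zero" using assms(2) by (auto simp: ga_nilpotent_def)
  have z: "z \<in> center" using assms(2) by simp
  have "a \<star> z = z \<star> a" using class_fun_commute[of z a] z by (simp add: center_iff)
  moreover have "(ga_mult G (z \<star> a) ^^ Suc n) e = ga_zero"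
    using z ga_pow_mult_central[of z "Suc n" a e] nilpotent_funpow_eq_0[OF n, of "Suc n"]
    by (simp only: center_iff)
  ultimately show ?thesis
    using nilpotent_if_pow[of "a \<star> z" "Suc n"] center_mult[OF assms(1) z] by simp
qed

text \<open>Let v be the last nonzero power of a, counted from e. Then a v = 0, so b v = v, which a
  nilpotent b does not allow.\<close>

lemma nilpotent_complement:
  assumes ab: "a \<in> center" "b \<in> center" "(\<lambda>x. a x + b x) = e"
  shows "\<not> (ga_nilpotent G a \<and> ga_nilpotent G b)"
proof
  assume nil: "ga_nilpotent G a \<and> ga_nilpotent G b"
  then obtain m n where m: "(ga_mult G a ^^ m) a = ga_zero" and n: "(ga_mult G b ^^ n) b = ga_zero"
    by (auto simp: ga_nilpotent_def)
  define i where "i = (LEAST i. (ga_mult G a ^^ i) e = ga_zero)"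
  have i: "(ga_mult G a ^^ i) e = ga_zero"
    unfolding i_def by (rule LeastI) (rule nilpotent_funpow_eq_0[OF m lessI])
  then obtain j where j: "i = Suc j" using e_nonzero by (cases i) auto
  define v where "v = (ga_mult G a ^^ j) e"
  have v0: "v \<noteq> ga_zero"
    using not_less_Least[of j "\<lambda>i. (ga_mult G a ^^ i) e = ga_zero"] j by (simp add: v_def i_def)
  have v: "v \<in> center" unfolding v_def by (rule center_pow[OF ab(1) e_in_center])
  have av: "a \<star> v = ga_zero" using i j by (simp add: v_def)
  have "v = (\<lambda>x. a x + b x) \<star> v" using v ab(3) by (simp add: center_iff)
  also have "\<dots> = b \<star> v" by (simp add: add_ga_mult av) (simp add: ga_zero_def)
  finally have bv: "b \<star> v = v" by simp
  have "(ga_mult G b ^^ l) v = v" for l by (induction l) (simp_all add: bv)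
  from trans[OF this[of "Suc n", symmetric] nilpotent_funpow_eq_0[OF n lessI]]
  show False using v0 by contradiction
qed

text \<open>A sum that is not nilpotent has an inverse y; then y a and y b are nilpotent with sum e,
  against \<open>nilpotent_complement\<close>.\<close>

lemma nil_center_add:
  assumes a: "a \<in> nil_center" and b: "b \<in> nil_center"
  shows "(\<lambda>x. a x + b x) \<in> nil_center"
proof -
  let ?s = "\<lambda>x. a x + b x"
  have s: "?s \<in> center"
    using a b by (auto simp: center_iff class_fun_add ga_mult_add)
  moreover have "ga_nilpotent G ?s"
  proof (rule ccontr)
    assume "\<not> ga_nilpotent G ?s"
    then obtain y where y: "y \<in> center" "?s \<star> y = e" using nilpotent_or_invertible[OF s] by blast
    have "y \<star> ?s = e" using y class_fun_commute[of y ?s] by (simp add: center_iff)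
    then have "(\<lambda>x. (y \<star> a) x + (y \<star> b) x) = e" by (simp add: ga_mult_add)
    then show False
      using nilpotent_complement nil_center_mult[OF y(1) a] nil_center_mult[OF y(1) b] by blast
  qed
  ultimately show ?thesis by simp
qed

lemma zero_in_center: "ga_zero \<in> center"
  by (simp add: center_iff) (simp add: class_fun_def ga_zero_def grp_alg_def)

lemma left_ideal_nil_center: "left_ideal G center nil_center"
  unfolding left_ideal_def
proof (intro conjI ballI allI)
  show "ga_zero \<in> nil_center"
    using zero_in_center nilpotent_if_pow[OF zero_in_center, of 1] by simp
  show "(\<lambda>g. c * x g) \<in> nil_center" if "x \<in> nil_center" for c x
  proof -
    have "(\<lambda>g. c * e g) \<in> center"
      using e_in_center by (simp add: center_iff class_fun_scale ga_mult_scale)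
    from nil_center_mult[OF this that] show ?thesis
      using that by (simp add: scale_ga_mult center_iff)
  qed
qed (use nil_center_add nil_center_mult in auto)

text \<open>Serves to bound the Jacobson radical from above. A left ideal with an element that is
  not nilpotent contains a unit of the center and hence everything.\<close>

lemma maximal_left_ideal_nil_center: "maximal_left_ideal G center nil_center"
  unfolding maximal_left_ideal_def
proof (intro conjI allI impI)
  show "nil_center \<noteq> center" using e_in_center e_not_nilpotent by blast
  fix K assume K: "left_ideal G center K \<and> nil_center \<subseteq> K \<and> K \<noteq> center"
  have "K \<subseteq> nil_center"
  proof
    fix z assume z: "z \<in> K"
    then have zc: "z \<in> center" using K by (auto simp: left_ideal_def)
    have "ga_nilpotent G z"
    proof (rule ccontr)
      assume "\<not> ga_nilpotent G z"
      then obtain y where y: "y \<in> center" "z \<star> y = e" using nilpotent_or_invertible[OF zc] by blast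
      have "y \<star> z = e" using y class_fun_commute[of y z] by (simp add: center_iff)
      then have e: "e \<in> K" using K y(1) z unfolding left_ideal_def by metis
      have "a \<in> K" if "a \<in> center" for a
        using K that e center_e[OF that] unfolding left_ideal_def by metis
      then show False using K by (auto simp: left_ideal_def)
    qed
    then show "z \<in> nil_center" using zc by simp
  qed
  then show "K = nil_center" using K by blast
qed (rule left_ideal_nil_center)

lemma jacobson_radical_subset: "jacobson_radical G center \<subseteq> nil_center"
  using maximal_left_ideal_nil_center unfolding jacobson_radical_def by blast

lemma zero_in_jacobson_radical: "ga_zero \<in> jacobson_radical G center"
  using zero_in_center by (auto simp: jacobson_radical_def maximal_left_ideal_def left_ideal_def)

lemma loewy_length_le:
  assumes N: "N \<ge> 1"
    and prod: "\<And>zs. \<forall>z\<in>set zs. class_fun G z \<and> ga_nilpotent G z \<Longrightarrow> length zs = N \<Longrightarrow>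
      foldr (\<star>) zs e = ga_zero"
  shows "loewy_length G center \<le> N"
proof -
  let ?J = "jacobson_radical G center"
  have J: "z \<in> center" "ga_nilpotent G z" if "z \<in> ?J" for z
    using that jacobson_radical_subset by auto
  \<comment> \<open>\<open>ws\<close> stores the radical factors already split off from a power of
    J. Since the center is commutative, the last factor of each generator moves into
    \<open>ws\<close>, and linearity disposes of the span.\<close>
  have step: "foldr (\<star>) ws x = ga_zero"
    if "x \<in> ideal_pow G center ?J (Suc n)" "set ws \<subseteq> ?J" "length ws + Suc n = N" for n x ws
    using that
  proof (induction n arbitrary: x ws)
    case 0
    then have x: "x \<in> ?J" by simp
    have "foldr (\<star>) (ws @ [x]) e = ga_zero"
      by (rule prod) (use 0 x J in \<open>auto simp: center_iff\<close>)
    then show ?case using center_e[OF J(1)[OF x]] by simp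
  next
    case (Suc n)
    then obtain S c where S: "S \<subseteq> {y \<star> j | y j. y \<in> ideal_pow G center ?J (Suc n) \<and> j \<in> ?J}"
      and x: "x = (\<lambda>g. \<Sum>s\<in>S. c s * s g)" by (auto simp: fspan_def)
    have "foldr (\<star>) ws s = ga_zero" if sS: "s \<in> S" for s
    proof -
      obtain y j where y: "y \<in> ideal_pow G center ?J (Suc n)" and j: "j \<in> ?J" and s: "s = y \<star> j"
        using S sS by blast
      have "s = j \<star> y" using class_fun_commute[of j y] J(1)[OF j] by (simp add: s center_iff)
      then have "foldr (\<star>) ws s = foldr (\<star>) (ws @ [j]) y" by simp
      also have "\<dots> = ga_zero" by (rule Suc.IH[OF y]) (use Suc.prems j in auto)
      finally show ?thesis .
    qed
    then show ?case unfolding x prod_lincomb by (simp add: ga_zero_def)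
  qed
  have "ideal_pow G center ?J N \<subseteq> {ga_zero}"
    using step[of _ "N - 1" "[]"] N by auto
  \<comment> \<open>The power must equal the zero ideal, so emptiness has to be excluded. The first
    power is J itself, the later ones are spans and contain the empty sum.\<close>
  moreover have "ga_zero \<in> ideal_pow G center ?J N"
  proof (cases "N = 1")
    case True
    then show ?thesis using zero_in_jacobson_radical by simp
  next
    case False
    then have "N = Suc (Suc (N - 2))" using N by linarith
    moreover have "ga_zero \<in> ideal_pow G center ?J (Suc (Suc n))" for n
      unfolding ideal_pow.simps fspan_def by (rule CollectI, rule exI[of _ "{}"]) (simp add: ga_zero_def)
    ultimately show ?thesis by metis
  qed
  ultimately have "N \<ge> 1 \<and> ideal_pow G center ?J N = {ga_zero}" using N by blast
  then show ?thesis unfolding loewy_length_def by (rule Least_le)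
qed

end

theorem theorem1p3:
  fixes G :: "('g,'b) monoid_scheme" and p d \<epsilon> :: nat
    and e :: "'g \<Rightarrow> 'f::field" and D :: "'g set"
  assumes "prime p"
    and "group G" and "finite (carrier G)"
    and "alg_closed_field TYPE('f)" and "CHAR('f) = p"
    and "block_idem G e"
    and "defect_group G e D"
    and "card D = p ^ d"
    and "subgroup_exponent G D = p ^ \<epsilon>"
  shows "loewy_length G (ga_center G (block_alg G e)) \<le> p ^ d - p ^ (d - \<epsilon>) + 1"
proof -
  interpret block G e
    using assms by (simp add: block_def block_axioms_def fin_group_def fin_group_axioms_def)
  have D: "subgroup D G" using assms(7) by (simp add: defect_group_def)
  obtain a where a: "a \<in> fixed_pts G D" "e = rel_trace G D a"
    using assms(7) by (auto simp: defect_group_def)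
  have E: "h [^]\<^bsub>G\<^esub> (p ^ \<epsilon>) = \<one>\<^bsub>G\<^esub>" if "h \<in> D" for h
  proof -
    \<comment> \<open>The order of G witnesses that the \<open>LEAST\<close> defining the exponent
      is attained.\<close>
    have "Coset.order G > 0 \<and> (\<forall>x\<in>D. x [^]\<^bsub>G\<^esub> Coset.order G = \<one>\<^bsub>G\<^esub>)"
      using pow_order_eq_1 subgroup.mem_carrier[OF D] assms(3) by (simp add: order_gt_0_iff_finite)
    from LeastI[of "\<lambda>n. n > 0 \<and> (\<forall>x\<in>D. x [^]\<^bsub>G\<^esub> n = \<one>\<^bsub>G\<^esub>)", OF this]
    show ?thesis using that assms(9) by (simp add: subgroup_exponent_def)
  qed
  show ?thesis
  proof (rule loewy_length_le)
    fix zs :: "('g \<Rightarrow> 'f) list"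
    assume zs: "\<forall>z\<in>set zs. class_fun G z \<and> ga_nilpotent G z" "length zs = p ^ d - p ^ (d - \<epsilon>) + 1"
    show "foldr (ga_mult G) zs e = ga_zero"
    proof (rule prod_eq_0[OF assms(1,5) e_class e_idem _ _ _ zs])
      show "small_defect G p d e"
        unfolding a(2) by (rule rel_trace_small_defect[OF assms(1,5) D assms(8) a(1)])
      show "u [^]\<^bsub>G\<^esub> (p ^ \<epsilon>) = \<one>\<^bsub>G\<^esub>"
        if "x \<in> carrier G" "e x \<noteq> 0" "u \<in> centralizer_of G x" "u [^]\<^bsub>G\<^esub> (p ^ k) = \<one>\<^bsub>G\<^esub>" for x u k
        using rel_trace_support_exponent[OF assms(1,5) D a(1) that(1) _ that(3,4) E] that(2) a(2) by simp
      \<comment> \<open>In the quotients the bound p^(d - n) of \<open>prod_defect_eq_0\<close> is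
        enough; the exponent of D is used for G only.\<close>
      show "foldr (ga_mult Q) ws e' = ga_zero"
        if "fin_group Q" "class_fun Q e'" "ga_mult Q e' e' = e'" "small_defect Q p (d - n) e'"
          "\<forall>z\<in>set ws. class_fun Q z \<and> ga_nilpotent Q z" "length ws = p ^ (d - n)"
        for n and Q :: "'g monoid" and e' :: "'g \<Rightarrow> 'f" and ws
        by (rule prod_defect_eq_0[OF assms(1,5) that])
    qed
  qed simp
qed

end
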